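(* Let $G$ be a finite group, let $X$ and $Y$ be compact $G$-metric spaces, let $p\in[1,\infty]$, and let $k\ge 0$ be an integer. Then $$2\,d_{\mathrm{GH}}^G(X,Y)\ \ge\ d_{\mathrm{HT}}^G\big((\mathcal{P}_{\mathrm{fin}}(X),\mathrm{diam}_p^X),(\mathcal{P}_{\mathrm{fin}}(Y),\mathrm{diam}_p^Y)\big),$$ and moreover $$d_{\mathrm{HT}}^G\big((\mathcal{P}_{\mathrm{fin}}(X),\mathrm{diam}_p^X),(\mathcal{P}_{\mathrm{fin}}(Y),\mathrm{diam}_p^Y)\big)\ \ge\ d_{\mathrm{I}}^G\big(\mathrm{H}_k(\mathrm{VR}^{\mathrm m}_p(X;\bullet)),\mathrm{H}_k(\mathrm{VR}^{\mathrm m}_p(Y;\bullet))\big)$$ and $$d_{\mathrm{HT}}^G\big((\mathcal{P}_{\mathrm{fin}}(X),\mathrm{diam}_p^X),(\mathcal{P}_{\mathrm{fin}}(Y),\mathrm{diam}_p^Y)\big)\ \ge\ \sup_{\varepsilon\ge 0}c_p^G(X,Y;\varepsilon),$$ where, for $\varepsilon>0$, $c_p^G(X,Y;\varepsilon):=\inf\{\eta>0:\text{there is a }G\text{-map }\mathrm{VR}^{\mathrm m}_p(Y;\varepsilon)\to\mathrm{VR}^{\mathrm m}_p(X;\varepsilon+\eta)\}$, and $c_p^G(X,Y;0):=\inf\{\eta>0:\text{there is a }G\text{-map }Y\to\mathrm{VR}^{\mathrm m}_p(X;\eta)\}$.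
   Context: Conventions: metric spaces are nonempty; $\inf\emptyset=+\infty$; "map" means continuous function; homology is singular homology with coefficients in a fixed field $\mathbb F$. $G$-spaces. A $G$-metric space is a metric space $(X,d_X)$ with a left action $\alpha_X:G\times X\to X$ such that each $\alpha_X(g,\cdot)$ is an isometry. A $G$-topological space is a topological space with a left $G$-action by homeomorphisms. A $G$-map is a continuous $G$-equivariant function. $G$-Gromov-Hausdorff distance. A $G$-correspondence between $X$ and $Y$ is a set $R\subseteq X\times Y$ whose projections to $X$ and to $Y$ are both surjective and such that $(\alpha_X(g,x),\alpha_Y(g,y))\in R$ for all $(x,y)\in R$, $g\in G$. Put $\mathrm{dis}(R):=\sup_{(x,y),(x',y')\in R}|d_X(x,x')-d_Y(y,y')|$ and $d_{\mathrm{GH}}^G(X,Y):=\frac12\inf_R\mathrm{dis}(R)$, the infimum over all $G$-correspondences. Measures. $\mathcal P_{\mathrm{fin}}(X)$ is the set of finitely supported Borel probability measures on $X$ with the weak topology, with $G$-action by push-forward $(g,\mu)\mapsto\alpha_X(g,\cdot)_\sharp\mu$. For $p<\infty$, $\mathrm{diam}_p^X(\mu):=\big(\iint d_X^p(x,x')\,d\mu(x)\,d\mu(x')\big)^{1/p}$; $\mathrm{diam}_\infty^X(\mu)$ is the diameter of the support of $\mu$. For $r>0$, $\mathrm{VR}^{\mathrm m}_p(X;r):=\{\mu\in\mathcal P_{\mathrm{fin}}(X):\mathrm{diam}_p^X(\mu)<r\}$ with the subspace topology and restricted $G$-action; for $r\le0$ it is empty. These are nested under inclusion as $r$ grows. $G$-homotopy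 type distance. Consider triples $(X,\alpha_X,\beta_X)$ with $(X,\alpha_X)$ a $G$-topological space and $\beta_X:X\to\mathbb R$ a $G$-invariant function. For $\delta\ge0$, a $(G,\delta)$-map $\Phi:X\to Y$ is a $G$-map with $\beta_Y(\Phi(x))\le\beta_X(x)+\delta$ for all $x$. Two $(G,\delta)$-maps $\Phi_0,\Phi_1$ are $(G,\delta)$-homotopic if there is a continuous $H:X\times[0,1]\to Y$ with $H(\cdot,0)=\Phi_0$, $H(\cdot,1)=\Phi_1$ and each $H(\cdot,t)$ a $(G,\delta)$-map. $X$ and $Y$ are $(G,\delta)$-homotopy equivalent if there are $(G,\delta)$-maps $\Phi:X\to Y$, $\Psi:Y\to X$ such that $\Psi\circ\Phi$ is $(G,2\delta)$-homotopic to $\mathrm{id}_X$ and $\Phi\circ\Psi$ is $(G,2\delta)$-homotopic to $\mathrm{id}_Y$. $d_{\mathrm{HT}}^G(X,Y)$ is the infimum of all $\delta\ge 0$ for which they are $(G,\delta)$-homotopy equivalent. $G$-interleaving distance. A persistence module $V_\bullet$ is a functor from $(\mathbb R,\le)$ to $\mathbb F$-vector spaces, with structure maps $v_{r,s}:V_r\to V_s$; a $G$-persistence module is a persistence module with a group homomorphism from $G$ to its group of automorphisms (natural isomorphisms). $G$-persistence morphisms are natural transformations commuting with the $G$-actions. $V_{\bullet+\delta}$ denotes the shift $r\mapsto V_{r+\delta}$. $V_\bullet,W_\bullet$ are $(G,\delta)$-interleaved if there are $G$-persistence morphisms $T_\bullet:V_\bullet\to W_{\bullet+\delta}$ and $T'_\bullet:W_\bullet\to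 V_{\bullet+\delta}$ with $T'_{r+\delta}\circ T_r=v_{r,r+2\delta}$ and $T_{r+\delta}\circ T'_r=w_{r,r+2\delta}$ for all $r$. $d_{\mathrm I}^G$ is the infimum of all $\delta\ge0$ for which they are $(G,\delta)$-interleaved. $\mathrm H_k(\mathrm{VR}^{\mathrm m}_p(X;\bullet))$ is the $G$-persistence module obtained by applying $\mathrm H_k(\cdot;\mathbb F)$ to the nested spaces $\mathrm{VR}^{\mathrm m}_p(X;r)$, $r\in\mathbb R$, with the $G$-action induced by push-forward. *)

theory Defs
  imports
    "HOL-Probability.Probability_Measure"
    "HOL-Algebra.Group_Action"
    "HOL-Algebra.AbelCoset"
    "HOL-Algebra.Module"
    "HOL-Algebra.Algebraic_Closure_Type"
    "HOL-Homology.Homology"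
begin

no_notation var (\<open>X\<index>\<close>)  \<comment> \<open>frees the name \<open>X\<close> for variables\<close>


section \<open>\<open>G\<close>-spaces\<close>

text \<open>
  A metric space is a whole type of class \<^class>\<open>metric_space\<close> (so it is nonempty); a topological
  space is an \<open>'a topology\<close> on its \<^const>\<open>topspace\<close>. All distances below take values in
  \<^typ>\<open>ereal\<close>, where the infimum of the empty set is \<open>\<infinity>\<close>.

  The elements of \<^term>\<open>BijGroup S\<close> are extensional functions, hence the restriction.
\<close>

definition acts_on :: "('g, 'm) monoid_scheme \<Rightarrow> 'a set \<Rightarrow> ('g \<Rightarrow> 'a \<Rightarrow> 'a) \<Rightarrow> bool" where
  "acts_on G S \<alpha> \<longleftrightarrow> group_action G S (\<lambda>g. restrict (\<alpha> g) S)"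

definition G_metric_space ::
    "('g, 'm) monoid_scheme \<Rightarrow> ('g \<Rightarrow> 'x::metric_space \<Rightarrow> 'x) \<Rightarrow> bool" where
  "G_metric_space G \<alpha> \<longleftrightarrow> acts_on G UNIV \<alpha> \<and>
     (\<forall>g\<in>carrier G. \<forall>x x'. dist (\<alpha> g x) (\<alpha> g x') = dist x x')"

definition G_topological_space ::
    "('g, 'm) monoid_scheme \<Rightarrow> 'a topology \<Rightarrow> ('g \<Rightarrow> 'a \<Rightarrow> 'a) \<Rightarrow> bool" where
  "G_topological_space G X \<alpha> \<longleftrightarrow> acts_on G (topspace X) \<alpha> \<and>
     (\<forall>g\<in>carrier G. homeomorphic_map X X (\<alpha> g))"

definition G_map ::
    "('g, 'm) monoid_scheme \<Rightarrow> 'a topology \<Rightarrow> ('g \<Rightarrow> 'a \<Rightarrow> 'a) \<Rightarrow>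
     'b topology \<Rightarrow> ('g \<Rightarrow> 'b \<Rightarrow> 'b) \<Rightarrow> ('a \<Rightarrow> 'b) \<Rightarrow> bool" where
  "G_map G X \<alpha>X Y \<alpha>Y f \<longleftrightarrow> continuous_map X Y f \<and>
     (\<forall>g\<in>carrier G. \<forall>x\<in>topspace X. f (\<alpha>X g x) = \<alpha>Y g (f x))"


section \<open>\<open>G\<close>-Gromov-Hausdorff distance\<close>

definition G_correspondence ::
    "('g, 'm) monoid_scheme \<Rightarrow> ('g \<Rightarrow> 'x \<Rightarrow> 'x) \<Rightarrow> ('g \<Rightarrow> 'y \<Rightarrow> 'y) \<Rightarrow> ('x \<times> 'y) set \<Rightarrow> bool" where
  "G_correspondence G \<alpha>X \<alpha>Y R \<longleftrightarrow> fst ` R = UNIV \<and> snd ` R = UNIV \<and>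
     (\<forall>(x, y)\<in>R. \<forall>g\<in>carrier G. (\<alpha>X g x, \<alpha>Y g y) \<in> R)"

definition distortion :: "('x::metric_space \<times> 'y::metric_space) set \<Rightarrow> ereal" where
  "distortion R = (SUP ((x, y), (x', y'))\<in>R \<times> R. ereal \<bar>dist x x' - dist y y'\<bar>)"

definition GH_dist ::
    "('g, 'm) monoid_scheme \<Rightarrow> ('g \<Rightarrow> 'x::metric_space \<Rightarrow> 'x) \<Rightarrow>
     ('g \<Rightarrow> 'y::metric_space \<Rightarrow> 'y) \<Rightarrow> ereal" where
  "GH_dist G \<alpha>X \<alpha>Y = ereal (1/2) * (INF R\<in>{R. G_correspondence G \<alpha>X \<alpha>Y R}. distortion R)"


section \<open>Finitely supported measures and Vietoris-Rips metric thickenings\<close>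

definition measure_support :: "'x::topological_space measure \<Rightarrow> 'x set" where
  "measure_support \<mu> = {x. \<forall>U. open U \<and> x \<in> U \<longrightarrow> measure \<mu> U > 0}"

definition P_fin :: "'x::topological_space measure set" where
  "P_fin = {\<mu>. sets \<mu> = sets borel \<and> prob_space \<mu> \<and> (\<exists>S. finite S \<and> measure \<mu> S = 1)}"

text \<open>
  The weak topology: the coarsest one making \<open>\<mu> \<mapsto> \<integral> f d\<mu>\<close> continuous for all bounded continuous \<open>f\<close>.
\<close>

definition P_fin_top :: "'x::topological_space measure topology" where
  "P_fin_top = topology_generated_by
     {{\<mu>\<in>P_fin. (\<integral>x. f x \<partial>\<mu>) \<in> U} | (f :: 'x \<Rightarrow> real) U.
        continuous_on UNIV f \<and> bounded (range f) \<and> open U}"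

definition push :: "('g \<Rightarrow> 'x \<Rightarrow> 'x) \<Rightarrow> 'g \<Rightarrow> 'x::topological_space measure \<Rightarrow> 'x measure" where
  "push \<alpha> g \<mu> = distr \<mu> borel (\<alpha> g)"

definition diam_p :: "ennreal \<Rightarrow> 'x::metric_space measure \<Rightarrow> real" where
  "diam_p p \<mu> =
     (if p = \<infinity> then diameter (measure_support \<mu>)
      else (\<integral>x. (\<integral>x'. dist x x' powr enn2real p \<partial>\<mu>) \<partial>\<mu>) powr (1 / enn2real p))"

definition VR_top :: "ennreal \<Rightarrow> real \<Rightarrow> 'x::metric_space measure topology" where
  "VR_top p r = subtopology P_fin_top {\<mu>\<in>P_fin. 0 < r \<and> diam_p p \<mu> < r}"


section \<open>\<open>G\<close>-homotopy type distance\<close>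

type_synonym ('g, 'a) G_triple = "'a topology \<times> ('g \<Rightarrow> 'a \<Rightarrow> 'a) \<times> ('a \<Rightarrow> real)"

definition G_triple :: "('g, 'm) monoid_scheme \<Rightarrow> ('g, 'a) G_triple \<Rightarrow> bool" where
  "G_triple G = (\<lambda>(X, \<alpha>, \<beta>). G_topological_space G X \<alpha> \<and>
     (\<forall>g\<in>carrier G. \<forall>x\<in>topspace X. \<beta> (\<alpha> g x) = \<beta> x))"

definition G_delta_map ::
    "('g, 'm) monoid_scheme \<Rightarrow> real \<Rightarrow> ('g, 'a) G_triple \<Rightarrow> ('g, 'b) G_triple \<Rightarrow>
     ('a \<Rightarrow> 'b) \<Rightarrow> bool" where
  "G_delta_map G \<delta> = (\<lambda>(X, \<alpha>X, \<beta>X) (Y, \<alpha>Y, \<beta>Y) \<Phi>.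
     G_map G X \<alpha>X Y \<alpha>Y \<Phi> \<and> (\<forall>x\<in>topspace X. \<beta>Y (\<Phi> x) \<le> \<beta>X x + \<delta>))"

text \<open>
  The library's \<^const>\<open>homotopic_with\<close> uses homotopies defined on \<open>[0,1] \<times> X\<close>, and requires the
  given property of every map \<open>H(t,\<cdot>)\<close> with \<open>t \<in> [0,1]\<close>, in particular of the two end maps.
\<close>

definition G_delta_homotopic ::
    "('g, 'm) monoid_scheme \<Rightarrow> real \<Rightarrow> ('g, 'a) G_triple \<Rightarrow> ('g, 'b) G_triple \<Rightarrow>
     ('a \<Rightarrow> 'b) \<Rightarrow> ('a \<Rightarrow> 'b) \<Rightarrow> bool" where
  "G_delta_homotopic G \<delta> A B \<Phi>0 \<Phi>1 \<longleftrightarrow>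
     homotopic_with (G_delta_map G \<delta> A B) (fst A) (fst B) \<Phi>0 \<Phi>1"

definition G_delta_homotopy_equivalent ::
    "('g, 'm) monoid_scheme \<Rightarrow> real \<Rightarrow> ('g, 'a) G_triple \<Rightarrow> ('g, 'b) G_triple \<Rightarrow> bool" where
  "G_delta_homotopy_equivalent G \<delta> A B \<longleftrightarrow> G_triple G A \<and> G_triple G B \<and>
     (\<exists>\<Phi> \<Psi>. G_delta_map G \<delta> A B \<Phi> \<and> G_delta_map G \<delta> B A \<Psi> \<and>
        G_delta_homotopic G (2 * \<delta>) A A (\<Psi> \<circ> \<Phi>) id \<and>
        G_delta_homotopic G (2 * \<delta>) B B (\<Phi> \<circ> \<Psi>) id)"

definition HT_dist ::
    "('g, 'm) monoid_scheme \<Rightarrow> ('g, 'a) G_triple \<Rightarrow> ('g, 'b) G_triple \<Rightarrow> ereal" where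
  "HT_dist G A B = (INF \<delta>\<in>{\<delta>. 0 \<le> \<delta> \<and> G_delta_homotopy_equivalent G \<delta> A B}. ereal \<delta>)"


section \<open>\<open>G\<close>-persistence modules and the \<open>G\<close>-interleaving distance\<close>

text \<open>
  The ground field is the whole type \<open>'f :: field\<close>. A vector space over it is a module with
  explicit carrier; the ring multiplication and unit that its record type inherits are unused.
\<close>

definition vec_space :: "('f::field, 'v) module \<Rightarrow> bool" where
  "vec_space V \<longleftrightarrow> Module.module (ring_of_type_algebra :: 'f ring) V"

definition linear_maps :: "('f, 'v) module \<Rightarrow> ('f, 'w) module \<Rightarrow> ('v \<Rightarrow> 'w) set" where
  "linear_maps V W = {T \<in> hom (add_monoid V) (add_monoid W).
     \<forall>c. \<forall>x\<in>carrier V. T (c \<odot>\<^bsub>V\<^esub> x) = c \<odot>\<^bsub>W\<^esub> T x}"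

record ('g, 'f, 'v) pers_module =
  pspace :: "real \<Rightarrow> ('f, 'v) module"
  pmap :: "real \<Rightarrow> real \<Rightarrow> 'v \<Rightarrow> 'v"  \<comment> \<open>only \<open>pmap V r s\<close> with \<open>r \<le> s\<close> is meaningful\<close>
  paction :: "'g \<Rightarrow> real \<Rightarrow> 'v \<Rightarrow> 'v"

definition persistence_module :: "('g, 'f::field, 'v) pers_module \<Rightarrow> bool" where
  "persistence_module V \<longleftrightarrow>
     (\<forall>r. vec_space (pspace V r)) \<and>
     (\<forall>r s. r \<le> s \<longrightarrow> pmap V r s \<in> linear_maps (pspace V r) (pspace V s)) \<and>
     (\<forall>r. \<forall>x\<in>carrier (pspace V r). pmap V r r x = x) \<and>
     (\<forall>r s t. r \<le> s \<and> s \<le> t \<longrightarrow>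
        (\<forall>x\<in>carrier (pspace V r). pmap V s t (pmap V r s x) = pmap V r t x))"

definition persistence_morphism ::
    "('g, 'f, 'v) pers_module \<Rightarrow> ('g, 'f, 'w) pers_module \<Rightarrow> (real \<Rightarrow> 'v \<Rightarrow> 'w) \<Rightarrow> bool" where
  "persistence_morphism V W T \<longleftrightarrow>
     (\<forall>r. T r \<in> linear_maps (pspace V r) (pspace W r)) \<and>
     (\<forall>r s. r \<le> s \<longrightarrow>
        (\<forall>x\<in>carrier (pspace V r). T s (pmap V r s x) = pmap W r s (T r x)))"

definition persistence_automorphism ::
    "('g, 'f, 'v) pers_module \<Rightarrow> (real \<Rightarrow> 'v \<Rightarrow> 'v) \<Rightarrow> bool" where
  "persistence_automorphism V T \<longleftrightarrow> persistence_morphism V V T \<and>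
     (\<forall>r. bij_betw (T r) (carrier (pspace V r)) (carrier (pspace V r)))"

definition G_persistence_module ::
    "('g, 'm) monoid_scheme \<Rightarrow> ('g, 'f::field, 'v) pers_module \<Rightarrow> bool" where
  "G_persistence_module G V \<longleftrightarrow> persistence_module V \<and>
     (\<forall>g\<in>carrier G. persistence_automorphism V (paction V g)) \<and>
     (\<forall>g\<in>carrier G. \<forall>h\<in>carrier G. \<forall>r. \<forall>x\<in>carrier (pspace V r).
        paction V (g \<otimes>\<^bsub>G\<^esub> h) r x = paction V g r (paction V h r x))"

definition G_persistence_morphism ::
    "('g, 'm) monoid_scheme \<Rightarrow> ('g, 'f, 'v) pers_module \<Rightarrow> ('g, 'f, 'w) pers_module \<Rightarrow>
     (real \<Rightarrow> 'v \<Rightarrow> 'w) \<Rightarrow> bool" where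
  "G_persistence_morphism G V W T \<longleftrightarrow> persistence_morphism V W T \<and>
     (\<forall>g\<in>carrier G. \<forall>r. \<forall>x\<in>carrier (pspace V r).
        T r (paction V g r x) = paction W g r (T r x))"

definition pshift :: "('g, 'f, 'v) pers_module \<Rightarrow> real \<Rightarrow> ('g, 'f, 'v) pers_module" where
  "pshift V \<delta> = \<lparr>pspace = (\<lambda>r. pspace V (r + \<delta>)),
                 pmap = (\<lambda>r s. pmap V (r + \<delta>) (s + \<delta>)),
                 paction = (\<lambda>g r. paction V g (r + \<delta>))\<rparr>"

definition G_interleaved ::
    "('g, 'm) monoid_scheme \<Rightarrow> real \<Rightarrow> ('g, 'f::field, 'v) pers_module \<Rightarrow>
     ('g, 'f, 'w) pers_module \<Rightarrow> bool" where
  "G_interleaved G \<delta> V W \<longleftrightarrow> G_persistence_module G V \<and> G_persistence_module G W \<and>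
     (\<exists>T T'. G_persistence_morphism G V (pshift W \<delta>) T \<and>
        G_persistence_morphism G W (pshift V \<delta>) T' \<and>
        (\<forall>r. \<forall>x\<in>carrier (pspace V r). T' (r + \<delta>) (T r x) = pmap V r (r + 2 * \<delta>) x) \<and>
        (\<forall>r. \<forall>y\<in>carrier (pspace W r). T (r + \<delta>) (T' r y) = pmap W r (r + 2 * \<delta>) y))"

definition interleaving_dist ::
    "('g, 'm) monoid_scheme \<Rightarrow> ('g, 'f::field, 'v) pers_module \<Rightarrow>
     ('g, 'f, 'w) pers_module \<Rightarrow> ereal" where
  "interleaving_dist G V W = (INF \<delta>\<in>{\<delta>. 0 \<le> \<delta> \<and> G_interleaved G \<delta> V W}. ereal \<delta>)"


section \<open>Singular homology with field coefficients\<close>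

text \<open>
  The library's singular homology has integer coefficients. The following mirrors its
  definitions, on the same singular simplices and faces, with coefficients in a field.
\<close>

type_synonym ('a, 'f) fchain = "((nat \<Rightarrow> real) \<Rightarrow> 'a) \<Rightarrow>\<^sub>0 'f"

definition fchain_scale :: "'f::field \<Rightarrow> ('a, 'f) fchain \<Rightarrow> ('a, 'f) fchain" where
  "fchain_scale c = Poly_Mapping.map ((*) c)"

definition fchain_extend ::
    "(((nat \<Rightarrow> real) \<Rightarrow> 'a) \<Rightarrow> ('b, 'f) fchain) \<Rightarrow> ('a, 'f::field) fchain \<Rightarrow> ('b, 'f) fchain" where
  "fchain_extend b z = (\<Sum>\<sigma>\<in>Poly_Mapping.keys z. fchain_scale (Poly_Mapping.lookup z \<sigma>) (b \<sigma>))"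

definition fchains :: "nat \<Rightarrow> 'a topology \<Rightarrow> ('a, 'f::field) fchain set" where
  "fchains n X = {z. Poly_Mapping.keys z \<subseteq> singular_simplex_set n X}"

definition fchain_boundary :: "nat \<Rightarrow> ('a, 'f::field) fchain \<Rightarrow> ('a, 'f) fchain" where
  "fchain_boundary n z =
     (if n = 0 then 0
      else fchain_extend
             (\<lambda>\<sigma>. \<Sum>k\<le>n. Poly_Mapping.single (singular_face n k \<sigma>) ((- 1) ^ k)) z)"

definition fchain_map :: "nat \<Rightarrow> ('a \<Rightarrow> 'b) \<Rightarrow> ('a, 'f::field) fchain \<Rightarrow> ('b, 'f) fchain" where
  "fchain_map n f = fchain_extend (\<lambda>\<sigma>. Poly_Mapping.single (simplex_map n f \<sigma>) 1)"

definition fcycle_space :: "nat \<Rightarrow> 'a topology \<Rightarrow> ('f::field, ('a, 'f) fchain) module" where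
  "fcycle_space n X =
     \<lparr>carrier = {z \<in> fchains n X. fchain_boundary n z = 0},
      monoid.mult = undefined, monoid.one = undefined,
      ring.zero = 0, ring.add = (+), module.smult = fchain_scale\<rparr>"

definition fboundaries :: "nat \<Rightarrow> 'a topology \<Rightarrow> ('a, 'f::field) fchain set" where
  "fboundaries n X = fchain_boundary (Suc n) ` fchains (Suc n) X"

definition quotient_space :: "('f, 'v) module \<Rightarrow> 'v set \<Rightarrow> ('f, 'v set) module" where
  "quotient_space V U =
     \<lparr>carrier = a_rcosets\<^bsub>V\<^esub> U,
      monoid.mult = undefined, monoid.one = undefined,
      ring.zero = U, ring.add = set_add V,
      module.smult = (\<lambda>c A. \<Union>a\<in>A. U +>\<^bsub>V\<^esub> (c \<odot>\<^bsub>V\<^esub> a))\<rparr>"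

definition fhomology :: "nat \<Rightarrow> 'a topology \<Rightarrow> ('f::field, ('a, 'f) fchain set) module" where
  "fhomology n X = quotient_space (fcycle_space n X) (fboundaries n X)"

text \<open>
  The map induced by \<open>f\<close> on homology, with target the homology of \<open>Y\<close>: the cosets in the union
  all coincide when \<open>A\<close> is a homology class of the source of \<open>f\<close>.
\<close>

definition fhom_induced ::
    "nat \<Rightarrow> 'b topology \<Rightarrow> ('a \<Rightarrow> 'b) \<Rightarrow> ('a, 'f::field) fchain set \<Rightarrow> ('b, 'f) fchain set" where
  "fhom_induced n Y f A =
     (\<Union>z\<in>A. fboundaries n Y +>\<^bsub>fcycle_space n Y\<^esub> fchain_map n f z)"

definition VR_homology ::
    "'f itself \<Rightarrow> nat \<Rightarrow> ennreal \<Rightarrow> ('g \<Rightarrow> 'x \<Rightarrow> 'x) \<Rightarrow>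
     ('g, 'f::field, ('x::metric_space measure, 'f) fchain set) pers_module" where
  "VR_homology _ k p \<alpha> =
     \<lparr>pspace = (\<lambda>r. fhomology k (VR_top p r)),
      pmap = (\<lambda>r s. fhom_induced k (VR_top p s) id),
      paction = (\<lambda>g r. fhom_induced k (VR_top p r) (push \<alpha> g))\<rparr>"


section \<open>The obstruction \<open>c\<close>\<close>

definition c_obs ::
    "('g, 'm) monoid_scheme \<Rightarrow> ennreal \<Rightarrow> ('g \<Rightarrow> 'x::metric_space \<Rightarrow> 'x) \<Rightarrow>
     ('g \<Rightarrow> 'y::metric_space \<Rightarrow> 'y) \<Rightarrow> real \<Rightarrow> ereal" where
  "c_obs G p \<alpha>X \<alpha>Y \<epsilon> =
     (if \<epsilon> = 0
      then INF \<eta>\<in>{\<eta>. 0 < \<eta> \<and> (\<exists>f. G_map G euclidean \<alpha>Y (VR_top p \<eta>) (push \<alpha>X) f)}. ereal \<eta>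
      else INF \<eta>\<in>{\<eta>. 0 < \<eta> \<and>
             (\<exists>f. G_map G (VR_top p \<epsilon>) (push \<alpha>Y) (VR_top p (\<epsilon> + \<eta>)) (push \<alpha>X) f)}. ereal \<eta>)"

end

theory Submission
  imports Defs "HOL-Probability.Probability_Mass_Function"
begin

text \<open>
  Every comparison map is induced by a Markov kernel: a kernel \<open>K\<close> sends each point \<open>x\<close> to a
  finitely supported probability measure \<open>K x\<close>, and a measure \<open>\<mu>\<close> to its mixture \<open>\<integral> K x d\<mu>(x)\<close>.
  If points drawn from \<open>K x\<close> and \<open>K x'\<close> are never further apart than \<open>dist x x' + c\<close>, then this map
  raises the \<open>p\<close>-diameter by at most \<open>c\<close>; for finite \<open>p\<close> this is Minkowski's inequality for the
  function \<open>dist\<close> and the constant \<open>c\<close> (\<open>diam_p_bind_le\<close>).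

  A \<open>G\<close>-correspondence \<open>R\<close> of distortion less than \<open>\<delta>\<close> yields such kernels. By compactness and
  finiteness of \<open>G\<close>, it contains a finite \<open>G\<close>-invariant set \<open>T\<close> of pairs whose projections are
  \<open>\<eta>\<close>-nets of both spaces (\<open>net_exists\<close>). A partition of unity indexed by the pairs in \<open>T\<close>, not by the
  points of the first space, sends \<open>x\<close> to a mixture of the points \<open>y\<close> with \<open>(s, y) \<in> T\<close> and \<open>s\<close> near
  \<open>x\<close>. It is continuous, and it is equivariant although a single choice of \<open>y\<close> for each \<open>s\<close> need not
  respect the stabiliser of \<open>s\<close> (\<open>equivariant_net_kernel\<close>). Going back and forth moves no point
  further than \<open>\<delta>\<close> (\<open>net_kernel_displacement\<close>), so the straight line from the composite to the
  identity is again given by kernels, now with constant \<open>2\<delta>\<close>. Hence the two spaces of measures are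
  \<open>(G, \<delta>)\<close>-homotopy equivalent, which is the upper bound.

  For the lower bounds, a \<open>(G, \<delta>)\<close>-homotopy equivalence restricts to maps from the thickening at scale
  \<open>r\<close> to the one at scale \<open>r + \<delta>\<close>, which are admissible in \<^const>\<open>c_obs\<close>; at \<open>\<epsilon> = 0\<close> they are
  preceded by the embedding of the space as Dirac measures. The homotopies restrict in the same way,
  so on homology the maps form an interleaving. This uses that homology over the field is a homotopy
  functor. The homotopy operator is found by acyclic models: over the integers, the cylinder over a
  simplex is contractible, so prism chains exist (\<open>prism_family_exists\<close>); reducing
  their coefficients gives the operator over any field (\<open>homotopic_fchain_map_boundary\<close>).
\<close>


section \<open>Prism chains on the cylinder over a simplex\<close>

abbreviation simplex_top :: "nat \<Rightarrow> (nat \<Rightarrow> real) topology" where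
  "simplex_top n \<equiv> subtopology (powertop_real UNIV) (standard_simplex n)"

abbreviation cylinder :: "'a topology \<Rightarrow> (real \<times> 'a) topology" where
  "cylinder X \<equiv> prod_topology (top_of_set {0..1}) X"

definition id_simplex :: "nat \<Rightarrow> (nat \<Rightarrow> real) \<Rightarrow> nat \<Rightarrow> real" where
  "id_simplex n = restrict id (standard_simplex n)"

lemma singular_id_simplex: "singular_simplex n (simplex_top n) (id_simplex n)"
proof -
  have "continuous_map (simplex_top n) (simplex_top n) (id_simplex n)"
    by (rule continuous_map_eq [OF continuous_map_id]) (auto simp: id_simplex_def)
  then show ?thesis by (simp add: singular_simplex_def id_simplex_def)
qed

lemma contractible_simplex_top: "contractible_space (simplex_top n)"
proof -
  define e :: "nat \<Rightarrow> real" where "e = (\<lambda>j. if j = 0 then 1 else 0)"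
  have e: "e \<in> standard_simplex n" by (simp add: e_def)
  let ?h = "\<lambda>(t::real, x::nat\<Rightarrow>real) i. (1 - t) * x i + t * e i"
  have "continuous_map (cylinder (simplex_top n)) (powertop_real UNIV) ?h"
    unfolding continuous_map_componentwise_UNIV
  proof
    fix i
    have "continuous_map (simplex_top n) euclideanreal (\<lambda>x. x i)"
      by (auto intro!: continuous_map_from_subtopology continuous_map_product_projection)
    then have "continuous_map (cylinder (simplex_top n)) euclideanreal (\<lambda>z. (snd z) i)"
      using continuous_map_compose[OF continuous_map_snd] by (fastforce simp: o_def)
    moreover have "continuous_map (cylinder (simplex_top n)) euclideanreal fst"
      using continuous_map_fst continuous_map_into_fulltopology by blast
    ultimately show "continuous_map (cylinder (simplex_top n)) euclideanreal (\<lambda>z. ?h z i)"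
      unfolding case_prod_unfold by (intro continuous_intros)
  qed
  moreover have "?h z \<in> standard_simplex n" if "z \<in> {0..1} \<times> standard_simplex n" for z
    using that e by (auto intro!: convex_standard_simplex)
  ultimately have "continuous_map (cylinder (simplex_top n)) (simplex_top n) ?h"
    by (auto simp: continuous_map_in_subtopology)
  then show ?thesis
    unfolding contractible_space_def homotopic_with_def
    by (intro exI[of _ e] exI[of _ ?h]) auto
qed

lemma contractible_cylinder: "contractible_space (cylinder (simplex_top n))"
  by (simp add: contractible_space_prod_topology contractible_simplex_top convex_imp_contractible)

text \<open>
  A cycle is homologous to its image under a constant map, and in positive degree every cycle of a
  one-point space bounds.
\<close>

lemma boundary_if_cycle_contractible:
  assumes X: "contractible_space X" and n: "1 \<le> n"
    and c: "singular_chain n X c" "chain_boundary n c = 0"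
  shows "\<exists>b. singular_chain (Suc n) X b \<and> chain_boundary (Suc n) b = c"
proof (cases "topspace X = {}")
  case True
  then have "c = 0" using c singular_chain_empty by blast
  then show ?thesis by (intro exI[of _ 0]) simp
next
  case False
  with X obtain a where a: "a \<in> topspace X"
    and hom: "homotopic_with (\<lambda>x. True) X X id (\<lambda>x. a)"
    by (auto simp: contractible_space)
  have cyc: "singular_relcycle n X {} c" using c by (simp add: singular_cycle)
  have "homologous_rel n X {} (chain_map n id c) (chain_map n (\<lambda>x. a) c)"
    by (rule homotopic_imp_homologous_rel_chain_maps[OF _ cyc]) (use hom in simp)
  moreover have "singular_relcycle n (subtopology X {a}) {} (chain_map n (\<lambda>x. a) c)"
    by (rule singular_relcycle_chain_map[OF cyc]) (use a in auto)
  then have "singular_relboundary n (subtopology X {a}) {} (chain_map n (\<lambda>x. a) c)"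
    using singular_boundary_eq_cycle_singleton[of "subtopology X {a}" a n] a n by simp
  then have "singular_relboundary n X {} (chain_map n (\<lambda>x. a) c)"
    using singular_boundary_mono[of "{a}" "topspace X" n X] a by simp
  ultimately have "singular_relboundary n X {} (chain_map n id c - chain_map n (\<lambda>x. a) c + chain_map n (\<lambda>x. a) c)"
    unfolding homologous_rel_def using singular_relboundary_add by blast
  then show ?thesis using c by (simp add: chain_map_ident singular_boundary)
qed

text \<open>
  A chain \<open>P\<close> on the cylinder over the \<open>n\<close>-simplex serves as a universal prism: the prism over a singular
  simplex \<open>\<sigma>\<close> along a homotopy \<open>h\<close> is the image of \<open>P\<close> under \<open>h \<circ> (id \<times> \<sigma>)\<close>.
\<close>

definition prism_push :: "(real \<times> 'a \<Rightarrow> 'b) \<Rightarrow> nat \<Rightarrow> (real \<times> (nat \<Rightarrow> real)) chain \<Rightarrow> ((nat \<Rightarrow> real) \<Rightarrow> 'a) \<Rightarrow> 'b chain" where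
  "prism_push h n P \<sigma> = chain_map (Suc n) (\<lambda>(t, z). h (t, \<sigma> z)) P"

text \<open>
  The boundary of a prism over the \<open>n\<close>-simplex is the top minus the bottom minus the prisms over the
  faces, where \<open>P'\<close> is the prism one dimension lower. For \<open>n = 0\<close> the truncated \<open>n - 1\<close> is harmless:
  \<^const>\<open>chain_boundary\<close> is zero in degree 0, so the last term vanishes.
\<close>

definition is_prism :: "nat \<Rightarrow> (real \<times> (nat \<Rightarrow> real)) chain \<Rightarrow> (real \<times> (nat \<Rightarrow> real)) chain \<Rightarrow> bool" where
  "is_prism n P' P \<longleftrightarrow> singular_chain (Suc n) (cylinder (simplex_top n)) P \<and>
     chain_boundary (Suc n) P =
       frag_of (simplex_map n (Pair 1) (id_simplex n)) - frag_of (simplex_map n (Pair 0) (id_simplex n))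
       - frag_extend (prism_push (\<lambda>z. z) (n - 1) P') (chain_boundary n (frag_of (id_simplex n)))"

lemma continuous_map_cylinder_map:
  assumes "continuous_map (cylinder X) Y h" "continuous_map S X \<sigma>"
  shows "continuous_map (cylinder S) Y (\<lambda>(t, z). h (t, \<sigma> z))"
proof -
  have "continuous_map (cylinder S) (cylinder X) (\<lambda>(t, z). (t, \<sigma> z))"
    using assms(2) by (simp add: continuous_map_prod_top)
  from continuous_map_compose[OF this assms(1)] show ?thesis
    by (simp add: o_def case_prod_unfold)
qed

lemma singular_chain_prism_push:
  assumes "continuous_map (cylinder X) Y h" "singular_simplex n X \<sigma>"
    and "singular_chain (Suc n) (cylinder (simplex_top n)) P"
  shows "singular_chain (Suc n) Y (prism_push h n P \<sigma>)"
  unfolding prism_push_def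
  by (rule singular_chain_chain_map[OF assms(3)])
     (use continuous_map_cylinder_map assms in \<open>auto simp: singular_simplex_def\<close>)

text \<open>
  Naturality: the defining equation of a universal prism is carried to every simplex and homotopy,
  because the faces of \<open>\<sigma>\<close> are the images of the faces of the identity simplex.
\<close>

lemma boundary_prism_push:
  assumes h: "continuous_map (cylinder X) Y h" and \<sigma>: "singular_simplex n X \<sigma>"
    and P: "is_prism n P' P"
    and P': "n > 0 \<Longrightarrow> singular_chain n (cylinder (simplex_top (n - 1))) P'"
  shows "chain_boundary (Suc n) (prism_push h n P \<sigma>) =
     frag_of (simplex_map n (\<lambda>x. h (1, x)) \<sigma>) - frag_of (simplex_map n (\<lambda>x. h (0, x)) \<sigma>)
     - frag_extend (prism_push h (n - 1) P') (chain_boundary n (frag_of \<sigma>))"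
proof -
  let ?f = "\<lambda>(t, z). h (t, \<sigma> z)"
  have P1: "singular_chain (Suc n) (cylinder (simplex_top n)) P" using P by (simp add: is_prism_def)
  have "chain_boundary (Suc n) (prism_push h n P \<sigma>) = chain_map n ?f (chain_boundary (Suc n) P)"
    unfolding prism_push_def using chain_boundary_chain_map[OF P1] by simp
  also have "\<dots> = frag_of (simplex_map n ?f (simplex_map n (Pair 1) (id_simplex n)))
      - frag_of (simplex_map n ?f (simplex_map n (Pair 0) (id_simplex n)))
      - chain_map n ?f (frag_extend (prism_push (\<lambda>z. z) (n - 1) P') (chain_boundary n (frag_of (id_simplex n))))"
    using P by (simp add: is_prism_def chain_map_diff)
  also have "simplex_map n ?f (simplex_map n (Pair 1) (id_simplex n)) = simplex_map n (\<lambda>x. h (1, x)) \<sigma>"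
    by (auto simp: simplex_map_def id_simplex_def)
  also have "simplex_map n ?f (simplex_map n (Pair 0) (id_simplex n)) = simplex_map n (\<lambda>x. h (0, x)) \<sigma>"
    by (auto simp: simplex_map_def id_simplex_def)
  also have "chain_map n ?f (frag_extend (prism_push (\<lambda>z. z) (n - 1) P') (chain_boundary n (frag_of (id_simplex n))))
      = frag_extend (prism_push h (n - 1) P') (chain_boundary n (frag_of \<sigma>))"
  proof (cases "n = 0")
    case False
    then have P'1: "singular_chain (Suc (n - 1)) (cylinder (simplex_top (n - 1))) P'" using P' by simp
    have face: "chain_map n ?f (prism_push (\<lambda>z. z) (n - 1) P' (singular_face n k (id_simplex n)))
        = prism_push h (n - 1) P' (singular_face n k \<sigma>)" if "k \<le> n" for k
    proof -
      have "chain_map n ?f (prism_push (\<lambda>z. z) (n - 1) P' (singular_face n k (id_simplex n)))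
        = chain_map n ?f (chain_map n (\<lambda>(t, z). (t, singular_face n k (id_simplex n) z)) P')"
        using False by (simp add: prism_push_def)
      also have "\<dots> = chain_map n (?f \<circ> (\<lambda>(t, z). (t, singular_face n k (id_simplex n) z))) P'"
        by (simp add: chain_map_compose)
      also have "\<dots> = chain_map n (\<lambda>(t, z). h (t, singular_face n k \<sigma> z)) P'"
      proof (rule chain_map_eq)
        show "singular_chain n (cylinder (simplex_top (n - 1))) P'" using P' False by simp
      qed (use False that simplical_face_in_standard_simplex in \<open>auto simp: singular_face_def id_simplex_def\<close>)
      finally show ?thesis using False by (simp add: prism_push_def)
    qed
    show ?thesis using False face
      by (simp add: chain_boundary_of frag_extend_sum frag_extend_cmul chain_map_sum o_def)
  qed (simp add: chain_boundary_def)
  finally show ?thesis .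
qed

text \<open>
  What the boundary of the next prism has to be is a cycle. The top and bottom terms cancel against
  those of the prisms over the faces; the prisms over the faces of faces cancel because the
  boundary of a boundary is zero.
\<close>

lemma prism_rhs_cycle:
  assumes P: "is_prism n P' P" and P': "n > 0 \<Longrightarrow> singular_chain n (cylinder (simplex_top (n - 1))) P'"
  defines "N \<equiv> Suc n"
  defines "c \<equiv> frag_of (simplex_map N (Pair 1) (id_simplex N)) - frag_of (simplex_map N (Pair 0) (id_simplex N))
       - frag_extend (prism_push (\<lambda>z. z) n P) (chain_boundary N (frag_of (id_simplex N)))"
  shows "singular_chain N (cylinder (simplex_top N)) c \<and> chain_boundary N c = 0"
proof
  let ?M = "cylinder (simplex_top N)" and ?i = "frag_of (id_simplex N)"
  have id: "singular_chain N (simplex_top N) ?i"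
    using singular_id_simplex by (simp add: singular_chain_of)
  have pair: "continuous_map (simplex_top N) ?M (Pair t)" if "t \<in> {0..1}" for t
    using that by (intro continuous_map_pairedI) auto
  have ends: "singular_chain N ?M (chain_map N (Pair t) ?i)" if "t \<in> {0..1}" for t
    using singular_chain_chain_map[OF id pair[OF that]] .
  have bd: "singular_chain n (simplex_top N) (chain_boundary N ?i)"
    using singular_chain_boundary[OF id] by (simp add: N_def)
  have P1: "singular_chain (Suc n) (cylinder (simplex_top n)) P" using P by (simp add: is_prism_def)
  have idc: "continuous_map ?M ?M (\<lambda>z. z)" by simp
  show "singular_chain N ?M c"
    unfolding c_def
  proof (intro singular_chain_diff)
    show "singular_chain N ?M (frag_of (simplex_map N (Pair 1) (id_simplex N)))"
      "singular_chain N ?M (frag_of (simplex_map N (Pair 0) (id_simplex N)))"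
      using ends[of 0] ends[of 1] by simp_all
    show "singular_chain N ?M (frag_extend (prism_push (\<lambda>z. z) n P) (chain_boundary N ?i))"
      using bd unfolding N_def singular_chain_def[of n]
      by (intro singular_chain_extend singular_chain_prism_push[OF _ _ P1, of "simplex_top N"])
         (auto simp: N_def)
  qed
  have lin: "chain_boundary N (frag_extend (prism_push (\<lambda>z. z) n P) z) =
       chain_map n (Pair 1) z - chain_map n (Pair 0) z - frag_extend (prism_push (\<lambda>z. z) (n - 1) P') (chain_boundary n z)"
    if "singular_chain n (simplex_top N) z" for z
    using that unfolding singular_chain_def
  proof (induction rule: frag_induction)
    case (one \<sigma>)
    then show ?case
      using boundary_prism_push[OF idc _ P P', of \<sigma>] by (simp add: N_def)
  next
    case (diff a b)
    then show ?case by (simp add: frag_extend_diff chain_boundary_diff chain_map_diff)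
  qed auto
  have "chain_boundary N c = chain_map n (Pair 1) (chain_boundary N ?i) - chain_map n (Pair 0) (chain_boundary N ?i)
       - chain_boundary N (frag_extend (prism_push (\<lambda>z. z) n P) (chain_boundary N ?i))"
    using chain_boundary_chain_map[OF id, of "Pair (1::real)"] chain_boundary_chain_map[OF id, of "Pair (0::real)"]
    by (simp add: c_def chain_boundary_diff N_def)
  also have "\<dots> = frag_extend (prism_push (\<lambda>z. z) (n - 1) P') (chain_boundary n (chain_boundary N ?i))"
    using lin[OF bd] by simp
  also have "chain_boundary n (chain_boundary N ?i) = 0"
    using chain_boundary_boundary[OF id] by (simp add: N_def)
  finally show "chain_boundary N c = 0" by simp
qed

text \<open>
  In dimension 0 the two ends of the interval are homologous; in each higher dimension the required
  boundary is a cycle on a contractible space, hence bounds.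
\<close>

lemma prism_family_exists:
  "\<exists>P. \<forall>n. is_prism n (P (n - 1)) (P n)"
proof -
  let ?R = "\<lambda>n (Q, P). is_prism n Q P \<and> (n > 0 \<longrightarrow> singular_chain n (cylinder (simplex_top (n - 1))) Q)"
  have "\<exists>f. \<forall>n. ?R n (f n) \<and> fst (f (Suc n)) = snd (f n)"
  proof (rule dependent_nat_choice)
    have id: "singular_chain 0 (simplex_top 0) (frag_of (id_simplex 0))"
      using singular_id_simplex by (simp add: singular_chain_of)
    \<comment> \<open>The identity of the cylinder is itself a homotopy between its two end inclusions.\<close>
    have "homotopic_with (\<lambda>h. h \<in> {} \<rightarrow> {}) (simplex_top 0) (cylinder (simplex_top 0)) (Pair 0) (Pair 1)"
      unfolding homotopic_with_def by (rule exI[of _ id]) auto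
    moreover have "singular_relcycle 0 (simplex_top 0) {} (frag_of (id_simplex 0))"
      using id by (simp add: singular_cycle chain_boundary_def)
    ultimately have "homologous_rel 0 (cylinder (simplex_top 0)) {}
        (chain_map 0 (Pair 0) (frag_of (id_simplex 0))) (chain_map 0 (Pair 1) (frag_of (id_simplex 0)))"
      by (rule homotopic_imp_homologous_rel_chain_maps)
    then have "singular_relboundary 0 (cylinder (simplex_top 0)) {}
        (chain_map 0 (Pair 1) (frag_of (id_simplex 0)) - chain_map 0 (Pair 0) (frag_of (id_simplex 0)))"
      by (subst (asm) homologous_rel_sym) (simp only: homologous_rel_def)
    then obtain P where "singular_chain (Suc 0) (cylinder (simplex_top 0)) P"
      and "chain_boundary (Suc 0) P = chain_map 0 (Pair 1) (frag_of (id_simplex 0))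
             - chain_map 0 (Pair 0) (frag_of (id_simplex 0))"
      unfolding singular_boundary by blast
    then have "is_prism 0 0 P"
      by (simp add: is_prism_def chain_boundary_of[of 0])
    then show "\<exists>x. ?R 0 x" by (intro exI[of _ "(0, P)"]) auto
  next
    fix x n assume R: "?R n x"
    obtain Q P where x: "x = (Q, P)" by force
    with R have P: "is_prism n Q P" "n > 0 \<Longrightarrow> singular_chain n (cylinder (simplex_top (n - 1))) Q" by auto
    from boundary_if_cycle_contractible[OF contractible_cylinder, of "Suc n"]
         prism_rhs_cycle[OF P]
    obtain P2 where "is_prism (Suc n) P P2"
      by (auto simp: is_prism_def)
    moreover have "singular_chain (Suc n) (cylinder (simplex_top n)) P"
      using P by (simp add: is_prism_def)
    ultimately show "\<exists>y. ?R (Suc n) y \<and> fst y = snd x"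
      by (intro exI[of _ "(P, P2)"]) (simp add: x)
  qed
  then obtain f where f: "\<forall>n. ?R n (f n) \<and> fst (f (Suc n)) = snd (f n)" ..
  have "is_prism n (snd (f (n - 1))) (snd (f n))" for n
  proof (cases n)
    case 0
    with f[rule_format, of 0] show ?thesis
      by (simp add: is_prism_def chain_boundary_of[of 0] case_prod_unfold)
  next
    case (Suc m)
    with f[rule_format, of n] f[rule_format, of m] show ?thesis
      by (simp add: case_prod_unfold)
  qed
  then show ?thesis by (intro exI[of _ "\<lambda>n. snd (f n)"]) simp
qed

lemma chain_homotopy_exists:
  assumes h: "continuous_map (cylinder X) Y h"
  shows "\<exists>D. \<forall>n \<sigma>. singular_simplex n X \<sigma> \<longrightarrow> singular_chain (Suc n) Y (D n \<sigma>) \<and>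
     chain_boundary (Suc n) (D n \<sigma>) =
       frag_of (simplex_map n (\<lambda>x. h (1, x)) \<sigma>) - frag_of (simplex_map n (\<lambda>x. h (0, x)) \<sigma>)
       - frag_extend (D (n - 1)) (chain_boundary n (frag_of \<sigma>))"
proof -
  obtain P where P: "\<And>n. is_prism n (P (n - 1)) (P n)" using prism_family_exists by blast
  have chain: "singular_chain (Suc n) (cylinder (simplex_top n)) (P n)" for n
    using P by (simp add: is_prism_def)
  have chain': "singular_chain n (cylinder (simplex_top (n - 1))) (P (n - 1))" if "n > 0" for n
    using chain[of "n - 1"] that by simp
  show ?thesis
    by (intro exI[of _ "\<lambda>n. prism_push h n (P n)"] allI impI conjI)
       (use singular_chain_prism_push[OF h _ chain] boundary_prism_push[OF h _ P chain'] in auto)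
qed


section \<open>Chains with coefficients in a field\<close>

lemma lookup_fchain_scale [simp]:
  "Poly_Mapping.lookup (fchain_scale c z) \<sigma> = c * Poly_Mapping.lookup z \<sigma>"
  by (simp add: fchain_scale_def Poly_Mapping.map.rep_eq when_def)

interpretation fchain: vector_space "fchain_scale :: 'f::field \<Rightarrow> ('a, 'f) fchain \<Rightarrow> ('a, 'f) fchain"
  by unfold_locales (auto intro!: poly_mapping_eqI simp: lookup_add algebra_simps)

abbreviation flinear :: "(('a, 'f::field) fchain \<Rightarrow> ('b, 'f) fchain) \<Rightarrow> bool" where
  "flinear \<equiv> Vector_Spaces.linear fchain_scale fchain_scale"

lemma flinear_compose: "flinear K \<Longrightarrow> flinear L \<Longrightarrow> flinear (\<lambda>z. K (L z))"
  using Vector_Spaces.linear_compose[of fchain_scale fchain_scale L fchain_scale K] by (simp add: o_def)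

lemma flinear_diff: "flinear K \<Longrightarrow> flinear L \<Longrightarrow> flinear (\<lambda>z. K z - L z)"
  by (auto simp: Vector_Spaces.linear_iff algebra_simps fchain.scale_right_diff_distrib)

lemma flinear_0: "flinear (\<lambda>z. 0)" and flinear_id: "flinear (\<lambda>z. z)"
  by (simp_all add: Vector_Spaces.linear_iff fchain.vector_space_axioms)

lemmas flinear_simps =
  module_hom.add[OF module_hom_iff_linear[THEN iffD2]] module_hom.diff[OF module_hom_iff_linear[THEN iffD2]]
  module_hom.scale[OF module_hom_iff_linear[THEN iffD2]] module_hom.zero[OF module_hom_iff_linear[THEN iffD2]]
  module_hom.sum[OF module_hom_iff_linear[THEN iffD2]]

lemma fchain_extend_superset:
  assumes "finite S" "Poly_Mapping.keys z \<subseteq> S"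
  shows "fchain_extend b z = (\<Sum>\<sigma>\<in>S. fchain_scale (Poly_Mapping.lookup z \<sigma>) (b \<sigma>))"
  unfolding fchain_extend_def using assms
  by (intro sum.mono_neutral_left) (auto simp: in_keys_iff)

lemma flinear_fchain_extend:
  fixes b :: "_ \<Rightarrow> ('b, 'f::field) fchain"
  shows "flinear (fchain_extend b :: ('a, 'f) fchain \<Rightarrow> _)"
  unfolding Vector_Spaces.linear_iff
proof (intro conjI allI fchain.vector_space_axioms)
  fix x y :: "('a, 'f) fchain" and c :: 'f
  let ?S = "Poly_Mapping.keys x \<union> Poly_Mapping.keys y"
  have "Poly_Mapping.keys (x + y) \<subseteq> ?S" by (rule keys_add)
  then show "fchain_extend b (x + y) = fchain_extend b x + fchain_extend b y"
    by (simp add: fchain_extend_superset[of ?S] lookup_add fchain.scale_left_distrib sum.distrib)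
  have "Poly_Mapping.keys (fchain_scale c x) \<subseteq> Poly_Mapping.keys x" by (auto simp: in_keys_iff)
  then show "fchain_extend b (fchain_scale c x) = fchain_scale c (fchain_extend b x)"
    by (simp add: fchain_extend_superset[of "Poly_Mapping.keys x"] fchain.scale_sum_right)
qed

lemma fchain_extend_single [simp]: "fchain_extend b (Poly_Mapping.single \<sigma> c) = fchain_scale c (b \<sigma>)"
  by (subst fchain_extend_superset[of "{\<sigma>}"]) auto

lemma fchain_expansion: "fchain_extend (\<lambda>\<sigma>. Poly_Mapping.single \<sigma> 1) z = z"
  by (rule poly_mapping_eqI)
     (simp add: fchain_extend_def lookup_sum lookup_single when_def in_keys_iff if_distrib cong: if_cong)

text \<open>
  Linear maps are compared on single simplices, where statements about integral chains apply.
\<close>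

lemma flinear_eqI:
  assumes K: "flinear K" and L: "flinear L"
    and eq: "\<And>\<sigma>. \<sigma> \<in> Poly_Mapping.keys z \<Longrightarrow> K (Poly_Mapping.single \<sigma> 1) = L (Poly_Mapping.single \<sigma> 1)"
  shows "K z = L z"
proof -
  have "K (fchain_extend (\<lambda>\<sigma>. Poly_Mapping.single \<sigma> 1) z) = L (fchain_extend (\<lambda>\<sigma>. Poly_Mapping.single \<sigma> 1) z)"
    using eq unfolding fchain_extend_def
    by (simp add: flinear_simps[OF K] flinear_simps[OF L])
  then show ?thesis by (simp add: fchain_expansion)
qed

text \<open>
  The reduction of coefficients along the ring map from the integers to the field. On single simplices
  every operation on chains over the field is the image of the corresponding integral one; this
  transfers the integral identities.
\<close>

definition of_int_chain :: "'a chain \<Rightarrow> ('a, 'f::field) fchain" where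
  "of_int_chain = Poly_Mapping.map of_int"

lemma lookup_of_int_chain [simp]:
  "Poly_Mapping.lookup (of_int_chain z) \<sigma> = of_int (Poly_Mapping.lookup z \<sigma>)"
  by (simp add: of_int_chain_def Poly_Mapping.map.rep_eq when_def)

lemma of_int_chain_add: "of_int_chain (x + y) = of_int_chain x + of_int_chain y"
  and of_int_chain_diff: "of_int_chain (x - y) = of_int_chain x - of_int_chain y"
  and of_int_chain_0 [simp]: "of_int_chain 0 = 0"
  and of_int_chain_cmul: "of_int_chain (frag_cmul k x) = fchain_scale (of_int k) (of_int_chain x)"
  and of_int_chain_of [simp]: "of_int_chain (frag_of \<sigma>) = Poly_Mapping.single \<sigma> 1"
  by (auto intro!: poly_mapping_eqI simp: lookup_add lookup_minus lookup_single when_def)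

lemma of_int_chain_sum: "of_int_chain (\<Sum>i\<in>I. f i) = (\<Sum>i\<in>I. of_int_chain (f i))"
  by (induction I rule: infinite_finite_induct) (auto simp: of_int_chain_add)

lemma of_int_chain_in_fchains:
  "singular_chain n X z \<Longrightarrow> (of_int_chain z :: ('a, 'f::field) fchain) \<in> fchains n X"
proof -
  have "Poly_Mapping.keys (of_int_chain z :: ('a, 'f::field) fchain) \<subseteq> Poly_Mapping.keys z"
    by (metis in_keys_iff lookup_of_int_chain of_int_0 subsetI)
  then show "singular_chain n X z \<Longrightarrow> (of_int_chain z :: ('a, 'f) fchain) \<in> fchains n X"
    by (auto simp: fchains_def singular_chain_def)
qed

lemma fchain_extend_of_int_chain:
  "fchain_extend (\<lambda>\<sigma>. of_int_chain (b \<sigma>)) (of_int_chain z) = of_int_chain (frag_extend b z)"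
  using subset_UNIV
  by (induction z rule: frag_induction)
     (auto simp: flinear_simps[OF flinear_fchain_extend] of_int_chain_diff frag_extend_diff)

lemma flinear_fchain_boundary: "flinear (fchain_boundary n)"
  unfolding fchain_boundary_def[abs_def] using flinear_fchain_extend flinear_0
  by (cases "n = 0") auto

lemma flinear_fchain_map: "flinear (fchain_map n f)"
  unfolding fchain_map_def by (rule flinear_fchain_extend)

lemma fchain_map_single [simp]:
  "fchain_map n f (Poly_Mapping.single \<sigma> c) = Poly_Mapping.single (simplex_map n f \<sigma>) c"
  by (auto simp: fchain_map_def lookup_single when_def intro!: poly_mapping_eqI)

lemma fchain_boundary_single:
  "fchain_boundary n (Poly_Mapping.single \<sigma> 1) = of_int_chain (chain_boundary n (frag_of \<sigma>))"
proof -
  have "Poly_Mapping.single \<tau> ((- 1) ^ k) = fchain_scale ((- 1) ^ k) (Poly_Mapping.single \<tau> (1::'b))"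
    for \<tau> :: "(nat \<Rightarrow> real) \<Rightarrow> 'a" and k :: nat
    by (rule poly_mapping_eqI) (simp add: lookup_single when_def)
  then show ?thesis
    by (auto simp: fchain_boundary_def chain_boundary_of of_int_chain_sum of_int_chain_cmul intro!: sum.cong)
qed

lemma fchain_boundary_of_int_chain:
  "fchain_boundary n (of_int_chain z) = of_int_chain (chain_boundary n z)"
  using subset_UNIV
  by (induction z rule: frag_induction)
     (auto simp: flinear_simps[OF flinear_fchain_boundary] of_int_chain_diff chain_boundary_diff fchain_boundary_single)

lemma fchain_map_of_int_chain:
  "fchain_map n f (of_int_chain z) = of_int_chain (chain_map n f z)"
  using subset_UNIV
  by (induction z rule: frag_induction)
     (auto simp: flinear_simps[OF flinear_fchain_map] of_int_chain_diff chain_map_diff)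

lemma fchain_boundary_map:
  assumes "z \<in> fchains n X"
  shows "fchain_boundary n (fchain_map n f z) = fchain_map (n - 1) f (fchain_boundary n z)"
proof (rule flinear_eqI[of "\<lambda>z. fchain_boundary n (fchain_map n f z)" "\<lambda>z. fchain_map (n - 1) f (fchain_boundary n z)"])
  fix \<sigma> assume "\<sigma> \<in> Poly_Mapping.keys z"
  then have "singular_chain n X (frag_of \<sigma>)"
    using assms by (auto simp: fchains_def singular_chain_of)
  from chain_boundary_chain_map[OF this, of f]
  show "fchain_boundary n (fchain_map n f (Poly_Mapping.single \<sigma> (1::'b))) = fchain_map (n - 1) f (fchain_boundary n (Poly_Mapping.single \<sigma> 1))"
    by (simp add: fchain_boundary_single fchain_map_of_int_chain)
qed (rule flinear_compose[OF flinear_fchain_boundary flinear_fchain_map]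
          flinear_compose[OF flinear_fchain_map flinear_fchain_boundary])+

lemma fchains_subspace:
  shows fchains_0: "0 \<in> fchains n X"
    and fchains_add: "x \<in> fchains n X \<Longrightarrow> y \<in> fchains n X \<Longrightarrow> x + y \<in> fchains n X"
    and fchains_scale: "x \<in> fchains n X \<Longrightarrow> fchain_scale c x \<in> fchains n X"
  using keys_add[of x y] by (auto simp: fchains_def in_keys_iff subset_iff)

lemma fchains_diff: "x \<in> fchains n X \<Longrightarrow> y \<in> fchains n X \<Longrightarrow> x - y \<in> fchains n X"
  using fchains_add[of x n X "fchain_scale (-1) y"] fchains_scale[of y n X "-1"] by simp

lemma fchain_extend_in_fchains:
  assumes "\<And>\<sigma>. \<sigma> \<in> Poly_Mapping.keys z \<Longrightarrow> b \<sigma> \<in> fchains n X"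
  shows "fchain_extend b z \<in> fchains n X"
proof -
  have "(\<Sum>\<sigma>\<in>S. fchain_scale (Poly_Mapping.lookup z \<sigma>) (b \<sigma>)) \<in> fchains n X"
    if "S \<subseteq> Poly_Mapping.keys z" for S
    using finite_subset[OF that finite_keys] that
    by (induction S rule: finite_induct) (auto simp: fchains_0 intro!: fchains_add fchains_scale assms)
  then show ?thesis by (simp add: fchain_extend_def)
qed

lemma fchain_map_in_fchains:
  assumes "continuous_map X Y f" "z \<in> fchains n X"
  shows "fchain_map n f z \<in> fchains n Y"
  unfolding fchain_map_def using assms
  by (intro fchain_extend_in_fchains) (auto simp: fchains_def singular_simplex_simplex_map subset_iff)

lemma fchain_map_cong:
  assumes "z \<in> fchains n X" "\<And>x. x \<in> topspace X \<Longrightarrow> f x = g x"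
  shows "fchain_map n f z = fchain_map n g z"
  by (rule flinear_eqI[OF flinear_fchain_map flinear_fchain_map])
     (use assms simplex_map_eq[of n X _ f g] in \<open>auto simp: fchains_def subset_iff\<close>)

lemma fchain_map_compose: "fchain_map n g (fchain_map n f z) = fchain_map n (g \<circ> f) z"
  by (rule flinear_eqI[OF flinear_compose[OF flinear_fchain_map flinear_fchain_map] flinear_fchain_map])
     (simp add: simplex_map_compose)

lemma fchain_map_id: "z \<in> fchains n X \<Longrightarrow> fchain_map n id z = z"
  by (rule flinear_eqI[OF flinear_fchain_map flinear_id])
     (auto simp: fchains_def subset_iff simplex_map_id_gen simp del: simplex_map_id)

text \<open>
  The integral homotopy operator has integral values on single simplices, so it extends linearly to
  chains over the field. Reducing only its effect on integral cycles would not suffice: in positive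
  characteristic not every cycle lifts to an integral one.
\<close>

lemma homotopic_fchain_map_boundary:
  fixes z :: "('a, 'f::field) fchain"
  assumes hom: "homotopic_with (\<lambda>h. True) X Y f g"
    and z: "z \<in> fchains n X" "fchain_boundary n z = 0"
  shows "fchain_map n g z - fchain_map n f z \<in> fboundaries n Y"
proof -
  obtain h where h: "continuous_map (cylinder X) Y h"
    and h01: "\<And>x. h (0, x) = f x" "\<And>x. h (1, x) = g x"
    using hom by (auto simp: homotopic_with_def)
  obtain D where D: "\<And>n \<sigma>. singular_simplex n X \<sigma> \<Longrightarrow> singular_chain (Suc n) Y (D n \<sigma>)"
    and bD: "\<And>n \<sigma>. singular_simplex n X \<sigma> \<Longrightarrow> chain_boundary (Suc n) (D n \<sigma>) =
       frag_of (simplex_map n g \<sigma>) - frag_of (simplex_map n f \<sigma>)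
       - frag_extend (D (n - 1)) (chain_boundary n (frag_of \<sigma>))"
    using chain_homotopy_exists[OF h] unfolding h01 by blast
  define E :: "nat \<Rightarrow> ('a, 'f) fchain \<Rightarrow> _" where "E n = fchain_extend (\<lambda>\<sigma>. of_int_chain (D n \<sigma>))" for n
  have E: "flinear (E n)" for n unfolding E_def by (rule flinear_fchain_extend)
  have "fchain_boundary (Suc n) (E n z) = fchain_map n g z - fchain_map n f z - E (n - 1) (fchain_boundary n z)"
  proof (rule flinear_eqI[where K = "\<lambda>z. fchain_boundary (Suc n) (E n z)" and
        L = "\<lambda>z. fchain_map n g z - fchain_map n f z - E (n - 1) (fchain_boundary n z)"])
    fix \<sigma> assume "\<sigma> \<in> Poly_Mapping.keys z"
    then have "singular_simplex n X \<sigma>" using z by (auto simp: fchains_def)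
    then show "fchain_boundary (Suc n) (E n (Poly_Mapping.single \<sigma> 1)) = fchain_map n g (Poly_Mapping.single \<sigma> 1)
        - fchain_map n f (Poly_Mapping.single \<sigma> 1) - E (n - 1) (fchain_boundary n (Poly_Mapping.single \<sigma> 1))"
      by (simp add: E_def fchain_boundary_of_int_chain bD of_int_chain_diff fchain_boundary_single
           fchain_extend_of_int_chain)
  qed (rule flinear_compose[OF flinear_fchain_boundary E] flinear_diff[OF flinear_diff]
          flinear_fchain_map flinear_compose[OF E flinear_fchain_boundary])+
  then have eq: "fchain_map n g z - fchain_map n f z = fchain_boundary (Suc n) (E n z)"
    using z by (simp add: flinear_simps[OF E])
  have "E n z \<in> fchains (Suc n) Y"
    unfolding E_def using z
    by (intro fchain_extend_in_fchains of_int_chain_in_fchains D) (auto simp: fchains_def)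
  then show ?thesis
    unfolding fboundaries_def eq by (rule imageI)
qed


section \<open>Homology over a field as a functor on vector spaces\<close>

abbreviation fcycles :: "nat \<Rightarrow> 'a topology \<Rightarrow> ('a, 'f::field) fchain set" where
  "fcycles n X \<equiv> carrier (fcycle_space n X)"

lemma fcycles_iff: "z \<in> fcycles n X \<longleftrightarrow> z \<in> fchains n X \<and> fchain_boundary n z = 0"
  by (simp add: fcycle_space_def)

lemma fcycles_subspace:
  shows fcycles_0: "0 \<in> fcycles n X"
    and fcycles_add: "x \<in> fcycles n X \<Longrightarrow> y \<in> fcycles n X \<Longrightarrow> x + y \<in> fcycles n X"
    and fcycles_scale: "x \<in> fcycles n X \<Longrightarrow> fchain_scale c x \<in> fcycles n X"
  by (auto simp: fcycles_iff fchains_0 fchains_add fchains_scale flinear_simps[OF flinear_fchain_boundary])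

lemma fboundaries_subspace:
  shows fboundaries_0: "0 \<in> fboundaries n X"
    and fboundaries_add: "x \<in> fboundaries n X \<Longrightarrow> y \<in> fboundaries n X \<Longrightarrow> x + y \<in> fboundaries n X"
    and fboundaries_scale: "x \<in> fboundaries n X \<Longrightarrow> fchain_scale c x \<in> fboundaries n X"
    and fboundaries_diff: "x \<in> fboundaries n X \<Longrightarrow> y \<in> fboundaries n X \<Longrightarrow> x - y \<in> fboundaries n X"
proof -
  show "0 \<in> fboundaries n X"
    unfolding fboundaries_def
    by (rule image_eqI[of _ _ 0]) (simp_all add: flinear_simps[OF flinear_fchain_boundary] fchains_0)
  show "x + y \<in> fboundaries n X" "x - y \<in> fboundaries n X"
    if xy: "x \<in> fboundaries n X" "y \<in> fboundaries n X"
  proof -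
    obtain u v where "u \<in> fchains (Suc n) X" "x = fchain_boundary (Suc n) u"
      and "v \<in> fchains (Suc n) X" "y = fchain_boundary (Suc n) v"
      using xy unfolding fboundaries_def by blast
    then show "x + y \<in> fboundaries n X" "x - y \<in> fboundaries n X"
      unfolding fboundaries_def
      by (auto simp: fchains_add fchains_diff simp flip: flinear_simps(1,2)[OF flinear_fchain_boundary])
  qed
  show "fchain_scale c x \<in> fboundaries n X" if "x \<in> fboundaries n X"
    using that unfolding fboundaries_def
    by (auto simp: fchains_scale simp flip: flinear_simps(3)[OF flinear_fchain_boundary])
qed

lemma fcycles_map: "continuous_map X Y f \<Longrightarrow> z \<in> fcycles n X \<Longrightarrow> fchain_map n f z \<in> fcycles n Y"
  by (auto simp: fcycles_iff fchain_map_in_fchains fchain_boundary_map flinear_simps[OF flinear_fchain_map])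

lemma fboundaries_map:
  assumes "continuous_map X Y f" "z \<in> fboundaries n X"
  shows "fchain_map n f z \<in> fboundaries n Y"
proof -
  obtain w where "w \<in> fchains (Suc n) X" "z = fchain_boundary (Suc n) w"
    using assms(2) by (auto simp: fboundaries_def)
  then have "fchain_map n f z = fchain_boundary (Suc n) (fchain_map (Suc n) f w)"
    by (simp add: fchain_boundary_map)
  with \<open>w \<in> _\<close> assms(1) show ?thesis
    unfolding fboundaries_def using fchain_map_in_fchains by blast
qed

text \<open>
  The same set as the coset of \<^const>\<open>a_r_coset\<close>, free of the surrounding module record.
\<close>

definition hclass :: "nat \<Rightarrow> 'a topology \<Rightarrow> ('a, 'f::field) fchain \<Rightarrow> ('a, 'f) fchain set" where
  "hclass n X z = (\<lambda>b. b + z) ` fboundaries n X"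

lemma coset_eq_hclass: "fboundaries n X +>\<^bsub>fcycle_space n X\<^esub> z = hclass n X z"
  by (auto simp: a_r_coset_def r_coset_def fcycle_space_def hclass_def)

lemma mem_hclass: "w \<in> hclass n X z \<longleftrightarrow> w - z \<in> fboundaries n X"
  by (auto simp: hclass_def image_iff) (metis diff_add_cancel)

lemma hclass_eq_iff: "hclass n X w = hclass n X z \<longleftrightarrow> w - z \<in> fboundaries n X"
proof
  assume "hclass n X w = hclass n X z"
  then show "w - z \<in> fboundaries n X" by (metis mem_hclass diff_self fboundaries_0)
next
  assume wz: "w - z \<in> fboundaries n X"
  have "v - w \<in> fboundaries n X \<longleftrightarrow> v - z \<in> fboundaries n X" for v
    using fboundaries_add[OF _ wz, of "v - w"] fboundaries_diff[OF _ wz, of "v - z"] by auto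
  then show "hclass n X w = hclass n X z" by (auto simp: mem_hclass)
qed

lemma carrier_fhomology: "carrier (fhomology n X) = hclass n X ` fcycles n X"
  by (auto simp: fhomology_def quotient_space_def A_RCOSETS_def RCOSETS_def
      coset_eq_hclass[unfolded a_r_coset_def])

lemma add_fhomology: "hclass n X w \<oplus>\<^bsub>fhomology n X\<^esub> hclass n X z = hclass n X (w + z)"
proof -
  have "hclass n X w \<oplus>\<^bsub>fhomology n X\<^esub> hclass n X z = {x + y |x y. x \<in> hclass n X w \<and> y \<in> hclass n X z}"
    by (auto simp: fhomology_def quotient_space_def set_add_def set_mult_def fcycle_space_def)
  also have "\<dots> = hclass n X (w + z)"
  proof (intro equalityI subsetI)
    fix u assume "u \<in> {x + y |x y. x \<in> hclass n X w \<and> y \<in> hclass n X z}"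
    then obtain x y where "u = x + y" "x - w \<in> fboundaries n X" "y - z \<in> fboundaries n X"
      by (auto simp: mem_hclass)
    then show "u \<in> hclass n X (w + z)"
      using fboundaries_add[of "x - w" n X "y - z"] by (simp add: mem_hclass algebra_simps)
  next
    fix u assume "u \<in> hclass n X (w + z)"
    then have "u - z \<in> hclass n X w" "z \<in> hclass n X z"
      by (auto simp: mem_hclass fboundaries_0 algebra_simps)
    then show "u \<in> {x + y |x y. x \<in> hclass n X w \<and> y \<in> hclass n X z}"
      by (metis (mono_tags, lifting) diff_add_cancel mem_Collect_eq)
  qed
  finally show ?thesis .
qed

text \<open>
  The union in the definitions of scalar multiplication and of induced maps is over representatives,
  all of which give the same coset.
\<close>

lemma UN_hclass:
  assumes "A = hclass n X z" "\<And>w. w \<in> A \<Longrightarrow> hclass n' Y (f w) = hclass n' Y (f z)"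
  shows "(\<Union>w\<in>A. hclass n' Y (f w)) = hclass n' Y (f z)"
proof (rule SUP_eq_const[OF _ assms(2)])
  show "A \<noteq> {}" using assms(1) fboundaries_0[of n X] by (auto simp: hclass_def)
qed

lemma smult_fhomology: "c \<odot>\<^bsub>fhomology n X\<^esub> hclass n X z = hclass n X (fchain_scale c z)"
proof -
  have "c \<odot>\<^bsub>fhomology n X\<^esub> hclass n X z = (\<Union>w\<in>hclass n X z. hclass n X (fchain_scale c w))"
    by (simp add: fhomology_def quotient_space_def coset_eq_hclass) (simp add: fcycle_space_def)
  also have "\<dots> = hclass n X (fchain_scale c z)"
    by (rule UN_hclass)
       (auto simp: hclass_eq_iff mem_hclass fboundaries_scale simp flip: fchain.scale_right_diff_distrib)
  finally show ?thesis .
qed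

lemma zero_fhomology: "\<zero>\<^bsub>fhomology n X\<^esub> = hclass n X 0"
  by (simp add: fhomology_def quotient_space_def hclass_def)

lemma fhom_induced_hclass:
  assumes "continuous_map X Y f"
  shows "fhom_induced n Y f (hclass n X z) = hclass n Y (fchain_map n f z)"
  unfolding fhom_induced_def coset_eq_hclass
  by (rule UN_hclass)
     (auto simp: hclass_eq_iff mem_hclass fboundaries_map[OF assms]
        simp flip: flinear_simps(2)[OF flinear_fchain_map])

lemma vec_space_fhomology: "vec_space (fhomology n X :: ('f::field, ('a, 'f) fchain set) module)"
  unfolding vec_space_def
proof (rule moduleI)
  show "cring (ring_of_type_algebra :: 'f ring)" by (rule cring_from_type_algebra)
  show "abelian_group (fhomology n X :: ('f::field, ('a, 'f) fchain set) module)"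
  proof (rule abelian_groupI)
    fix A :: "('a, 'f) fchain set" assume "A \<in> carrier (fhomology n X)"
    then obtain z where z: "z \<in> fcycles n X" "A = hclass n X z" by (auto simp: carrier_fhomology)
    have "hclass n X (fchain_scale (-1) z) \<in> carrier (fhomology n X)"
      unfolding carrier_fhomology by (intro imageI fcycles_scale z)
    moreover have "hclass n X (fchain_scale (-1) z) \<oplus>\<^bsub>fhomology n X\<^esub> A = \<zero>\<^bsub>fhomology n X\<^esub>"
      by (simp add: z add_fhomology zero_fhomology)
    ultimately show "\<exists>B\<in>carrier (fhomology n X). B \<oplus>\<^bsub>fhomology n X\<^esub> A = \<zero>\<^bsub>fhomology n X\<^esub>" by blast
  qed (auto simp: carrier_fhomology add_fhomology zero_fhomology fcycles_0 fcycles_add algebra_simps)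
qed (auto simp: carrier_fhomology add_fhomology smult_fhomology fcycles_scale ring_of_type_algebra_def
      fchain.scale_left_distrib fchain.scale_right_distrib)

lemma fhom_induced_linear:
  assumes "continuous_map X Y f"
  shows "fhom_induced n Y f \<in> linear_maps (fhomology n X) (fhomology n Y :: ('f::field, _) module)"
  unfolding linear_maps_def hom_def
  by (auto simp: carrier_fhomology fhom_induced_hclass[OF assms] add_fhomology smult_fhomology
        fcycles_map[OF assms] flinear_simps[OF flinear_fchain_map])

lemma fhom_induced_closed:
  assumes "continuous_map X Y f" "A \<in> carrier (fhomology n X)"
  shows "fhom_induced n Y f A \<in> carrier (fhomology n Y)"
  using assms(2) by (auto simp: carrier_fhomology fhom_induced_hclass[OF assms(1)] fcycles_map[OF assms(1)])

lemma fhom_induced_compose: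
  assumes "continuous_map X Y f" "continuous_map Y Z g" "A \<in> carrier (fhomology n X)"
  shows "fhom_induced n Z g (fhom_induced n Y f A) = fhom_induced n Z (g \<circ> f) A"
  using assms continuous_map_compose[OF assms(1,2)]
  by (auto simp: carrier_fhomology fhom_induced_hclass fchain_map_compose)

lemma fhom_induced_cong:
  assumes "continuous_map X Y f" "A \<in> carrier (fhomology n X)" "\<And>x. x \<in> topspace X \<Longrightarrow> f x = g x"
  shows "fhom_induced n Y f A = fhom_induced n Y g A"
proof -
  have "continuous_map X Y g" using assms continuous_map_eq by blast
  moreover obtain z where "z \<in> fchains n X" "A = hclass n X z"
    using assms(2) by (auto simp: carrier_fhomology fcycles_iff)
  ultimately show ?thesis
    using fchain_map_cong[of z n X f g] assms by (simp add: fhom_induced_hclass)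
qed

lemma fhom_induced_id: "A \<in> carrier (fhomology n X) \<Longrightarrow> fhom_induced n X id A = A"
  by (auto simp: carrier_fhomology fhom_induced_hclass[of X X] fchain_map_id fcycles_iff)

text \<open>
  On cycles the two chain maps differ by boundaries.
\<close>

lemma fhom_induced_homotopic:
  assumes "homotopic_with (\<lambda>h. True) X Y f g" "A \<in> carrier (fhomology n X)"
  shows "fhom_induced n Y f A = fhom_induced n Y g A"
proof -
  have "continuous_map X Y f" "continuous_map X Y g"
    using homotopic_with_imp_continuous_maps[OF assms(1)] by auto
  moreover obtain z where "z \<in> fchains n X" "fchain_boundary n z = 0" "A = hclass n X z"
    using assms(2) by (auto simp: carrier_fhomology fcycles_iff)
  ultimately show ?thesis
    using homotopic_fchain_map_boundary[OF homotopic_with_symD[OF assms(1)], of z n]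
    by (simp add: fhom_induced_hclass hclass_eq_iff)
qed


section \<open>Finitely supported measures as probability mass functions\<close>

text \<open>
  In a metric space finite sets are Borel, so finitely supported Borel probability measures are the same
  as finitely supported probability mass functions. On the latter, mixtures are the monadic bind.
\<close>

definition pmf_measure :: "'x::metric_space pmf \<Rightarrow> 'x measure" where
  "pmf_measure q = distr (measure_pmf q) borel id"

lemma sets_pmf_measure [simp]: "sets (pmf_measure q) = sets borel"
  by (simp add: pmf_measure_def)

lemma measure_pmf_measure: "A \<in> sets borel \<Longrightarrow> measure (pmf_measure q) A = measure (measure_pmf q) A"
  by (simp add: pmf_measure_def measure_distr)

lemma integral_pmf_measure:
  fixes f :: "'x::metric_space \<Rightarrow> real"
  assumes "continuous_on UNIV f"
  shows "(\<integral>x. f x \<partial>pmf_measure q) = measure_pmf.expectation q f"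
  using borel_measurable_continuous_onI[OF assms] by (simp add: pmf_measure_def integral_distr)

lemma finite_imp_borel: "finite S \<Longrightarrow> S \<in> sets (borel :: 'x::metric_space measure)"
  by (intro borel_closed finite_imp_closed)

lemma pmf_measure_singleton: "measure (pmf_measure q) {x} = pmf q x"
  by (simp add: measure_pmf_measure finite_imp_borel measure_pmf_single)

lemma pmf_measure_inject [simp]: "pmf_measure p = pmf_measure q \<longleftrightarrow> p = q"
  by (metis pmf_eqI pmf_measure_singleton)

lemma pmf_measure_in_P_fin: "finite (set_pmf q) \<Longrightarrow> pmf_measure q \<in> P_fin"
proof -
  assume q: "finite (set_pmf q)"
  have "prob_space (pmf_measure q)"
    unfolding pmf_measure_def by (rule measure_pmf.prob_space_distr) simp
  moreover have "measure (pmf_measure q) (set_pmf q) = 1"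
    using q by (simp add: measure_pmf_measure finite_imp_borel measure_pmf.prob_eq_1 AE_measure_pmf)
  ultimately show ?thesis using q by (auto simp: P_fin_def)
qed

text \<open>
  The masses of the points of a finite set of full measure define the mass function.
\<close>

lemma P_fin_cases:
  assumes "\<mu> \<in> P_fin"
  obtains q where "\<mu> = pmf_measure q" "finite (set_pmf q)"
proof -
  from assms obtain S where S: "sets \<mu> = sets borel" "finite S" "measure \<mu> S = 1" and "prob_space \<mu>"
    by (auto simp: P_fin_def)
  then interpret prob_space \<mu> by simp
  define w where "w x = (if x \<in> S then measure \<mu> {x} else 0)" for x
  have in_sets: "finite A \<Longrightarrow> A \<in> sets \<mu>" for A using S(1) finite_imp_borel by simp
  have sum: "measure \<mu> A = (\<Sum>x\<in>A. measure \<mu> {x})" if "finite A" for A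
    using that in_sets by (intro finite_measure_eq_sum_singleton) auto
  have "(\<integral>\<^sup>+x. ennreal (w x) \<partial>count_space UNIV) = (\<Sum>x\<in>S. ennreal (w x))"
    using S(2) by (intro nn_integral_count_space'[of S]) (auto simp: w_def)
  also have "\<dots> = ennreal (\<Sum>x\<in>S. w x)" by (intro sum_ennreal) (auto simp: w_def)
  also have "(\<Sum>x\<in>S. w x) = 1" using S sum[of S] by (simp add: w_def)
  finally have w: "(\<integral>\<^sup>+x. ennreal (w x) \<partial>count_space UNIV) = 1" by simp
  have w0: "0 \<le> w x" for x by (simp add: w_def)
  have set: "set_pmf (embed_pmf w) \<subseteq> S" unfolding set_embed_pmf[OF w0 w] by (auto simp: w_def)
  have "\<mu> = pmf_measure (embed_pmf w)"
  proof (rule measure_eqI)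
    fix A assume "A \<in> sets \<mu>"
    then have A: "A \<in> sets borel" using S by simp
    have "measure \<mu> A = measure \<mu> (A \<inter> S)"
    proof (rule finite_measure_eq_AE)
      have "AE x in \<mu>. x \<in> S" using S in_sets[OF S(2)] by (simp add: AE_in_set_eq_1)
      then show "AE x in \<mu>. x \<in> A \<longleftrightarrow> x \<in> A \<inter> S" by auto
    qed (use A S in_sets in auto)
    also have "\<dots> = (\<Sum>x\<in>A \<inter> S. w x)" using S sum[of "A \<inter> S"] by (simp add: w_def)
    also have "\<dots> = measure (measure_pmf (embed_pmf w)) (A \<inter> S)"
      using S pmf_embed_pmf[OF w0 w] by (simp add: measure_measure_pmf_finite)
    also have "\<dots> = measure (measure_pmf (embed_pmf w)) A"
      using set by (intro measure_pmf.finite_measure_eq_AE) (auto simp: AE_measure_pmf_iff)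
    finally have "measure \<mu> A = measure (pmf_measure (embed_pmf w)) A"
      using A by (simp add: measure_pmf_measure)
    moreover have "prob_space (pmf_measure (embed_pmf w))"
      using pmf_measure_in_P_fin[OF finite_subset[OF set S(2)]] by (simp add: P_fin_def)
    ultimately show "emeasure \<mu> A = emeasure (pmf_measure (embed_pmf w)) A"
      by (simp add: emeasure_eq_measure finite_measure.emeasure_eq_measure prob_space.finite_measure)
  qed (simp add: S)
  with that finite_subset[OF set S(2)] show thesis by blast
qed

definition measure_to_pmf :: "'x::metric_space measure \<Rightarrow> 'x pmf" where
  "measure_to_pmf \<mu> = (THE q. pmf_measure q = \<mu>)"

lemma measure_to_pmf_pmf_measure [simp]: "measure_to_pmf (pmf_measure q) = q"
  by (simp add: measure_to_pmf_def)

lemma measure_support_pmf_measure: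
  assumes "finite (set_pmf q)"
  shows "measure_support (pmf_measure q) = set_pmf q"
proof (intro equalityI subsetI)
  fix x assume "x \<in> measure_support (pmf_measure q)"
  moreover have "open (- set_pmf q)" using assms by (simp add: finite_imp_closed open_Compl)
  moreover have "measure (pmf_measure q) (- set_pmf q) = 0"
    using \<open>open (- set_pmf q)\<close>
    by (simp add: measure_pmf_measure measure_pmf_zero_iff)
  ultimately show "x \<in> set_pmf q"
    unfolding measure_support_def by fastforce
next
  fix x assume x: "x \<in> set_pmf q"
  have "measure (pmf_measure q) U > 0" if "open U" "x \<in> U" for U
    using that x by (simp add: measure_pmf_measure measure_pmf_posI)
  then show "x \<in> measure_support (pmf_measure q)" by (simp add: measure_support_def)
qed


section \<open>The \<open>p\<close>-diameter under Markov kernels\<close>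

lemma expectation_mono_finite:
  fixes f g :: "'a \<Rightarrow> real"
  assumes "finite (set_pmf q)" "\<And>x. x \<in> set_pmf q \<Longrightarrow> f x \<le> g x"
  shows "measure_pmf.expectation q f \<le> measure_pmf.expectation q g"
  using assms by (intro integral_mono_AE integrable_measure_pmf_finite) (auto simp: AE_measure_pmf_iff)

lemma expectation_bind:
  fixes f :: "'b \<Rightarrow> real"
  assumes "finite (set_pmf q)" "\<And>x. x \<in> set_pmf q \<Longrightarrow> finite (set_pmf (K x))"
  shows "measure_pmf.expectation (bind_pmf q K) f = measure_pmf.expectation q (\<lambda>x. measure_pmf.expectation (K x) f)"
  using assms by (subst pmf_expectation_bind[of "set_pmf q"]) (auto simp: integral_measure_pmf[of "set_pmf q"])

lemma expectation_pair:
  fixes f :: "'a \<times> 'b \<Rightarrow> real"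
  assumes "finite (set_pmf p)" "finite (set_pmf q)"
  shows "measure_pmf.expectation (pair_pmf p q) f
     = measure_pmf.expectation p (\<lambda>x. measure_pmf.expectation q (\<lambda>y. f (x, y)))"
  using assms by (simp add: pair_pmf_def expectation_bind)

lemma powr_mean_le:
  fixes a u r :: real
  assumes "0 \<le> a" "a \<le> 1" "0 \<le> u" "1 \<le> r"
  shows "(a * u + (1 - a)) powr r \<le> a * u powr r + (1 - a)"
proof (cases "u = 0")
  case True
  have "(1 - a) powr r \<le> (1 - a) powr 1"
    using assms by (intro powr_mono') auto
  then show ?thesis using True assms by simp
next
  case False
  then have "convex_on {0<..} (\<lambda>x::real. x powr r)" "u \<in> {0<..}"
    using assms by (auto intro!: powr_convex)
  from convex_onD[OF this(1), of "1 - a" u 1] this(2) assms show ?thesis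
    by (simp add: algebra_simps)
qed

text \<open>
  By convexity of \<open>t powr r\<close>, applied to \<open>(f x + c) / (m + c)\<close>, which is the mean of \<open>f x / m\<close> and \<open>1\<close> with
  weights \<open>m / (m + c)\<close> and \<open>c / (m + c)\<close>, for any \<open>m\<close> exceeding the \<open>r\<close>-norm of \<open>f\<close>. Choosing \<open>m\<close>
  strictly larger than the norm avoids division by zero when \<open>f\<close> vanishes.
\<close>

lemma Minkowski_add_const:
  fixes f :: "'a \<Rightarrow> real"
  assumes q: "finite (set_pmf q)" and f: "\<And>x. 0 \<le> f x" and c: "0 \<le> c" and r: "1 \<le> r"
  shows "measure_pmf.expectation q (\<lambda>x. (f x + c) powr r) powr (1 / r)
       \<le> measure_pmf.expectation q (\<lambda>x. f x powr r) powr (1 / r) + c"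
proof (rule field_le_epsilon)
  let ?E = "measure_pmf.expectation q"
  fix e :: real assume e: "0 < e"
  define m where "m = ?E (\<lambda>x. f x powr r) powr (1 / r) + e"
  have E0: "0 \<le> ?E (\<lambda>x. f x powr r)" by (intro integral_nonneg_AE) simp
  have m: "0 < m" using e by (simp add: m_def add_nonneg_pos)
  have "?E (\<lambda>x. f x powr r) = (?E (\<lambda>x. f x powr r) powr (1 / r)) powr r"
    using E0 r by (simp add: powr_powr)
  also have "\<dots> \<le> m powr r" using r e by (intro powr_mono2) (auto simp: m_def)
  finally have Em: "?E (\<lambda>x. f x powr r) \<le> m powr r" .
  define a where "a = m / (m + c)"
  have a: "0 < a" "a \<le> 1" using m c by (auto simp: a_def)
  have bc: "1 - a = c / (m + c)" using m c by (simp add: a_def field_simps)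
  have int: "integrable (measure_pmf q) g" for g :: "'a \<Rightarrow> real"
    using q by (rule integrable_measure_pmf_finite)
  have pw: "(f x + c) powr r \<le> (m + c) powr r * (a * (f x powr r / m powr r) + (1 - a))" for x
  proof -
    have "((f x + c) / (m + c)) powr r = (a * (f x / m) + (1 - a) * 1) powr r"
    proof -
      have "a * (f x / m) = f x / (m + c)" using m by (simp add: a_def)
      then show ?thesis by (simp add: bc add_divide_distrib)
    qed
    also have "\<dots> \<le> a * (f x / m) powr r + (1 - a) * 1 powr r"
      using powr_mean_le[of a "f x / m" r] a r f[of x] m by simp
    finally have "(f x + c) powr r / (m + c) powr r \<le> a * (f x powr r / m powr r) + (1 - a)"
      using m c f[of x] by (simp add: powr_divide)
    moreover have "0 < (m + c) powr r" using m c by simp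
    ultimately show ?thesis by (simp only: pos_divide_le_eq mult.commute[of "(m + c) powr r"])
  qed
  have "?E (\<lambda>x. (f x + c) powr r) \<le> ?E (\<lambda>x. (m + c) powr r * (a * (f x powr r / m powr r) + (1 - a)))"
    using q pw by (rule expectation_mono_finite)
  also have "\<dots> = (m + c) powr r * (a * (?E (\<lambda>x. f x powr r) / m powr r) + (1 - a))"
    using int by simp
  also have "\<dots> \<le> (m + c) powr r * (a * 1 + (1 - a))"
    using Em m a by (intro mult_left_mono add_right_mono) (auto simp: divide_simps)
  finally have "?E (\<lambda>x. (f x + c) powr r) powr (1 / r) \<le> ((m + c) powr r) powr (1 / r)"
    using r by (intro powr_mono2) (auto intro!: integral_nonneg_AE)
  also have "\<dots> = m + c" using m c r by (simp add: powr_powr)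
  finally show "?E (\<lambda>x. (f x + c) powr r) powr (1 / r) \<le> ?E (\<lambda>x. f x powr r) powr (1 / r) + c + e"
    by (simp add: m_def)
qed

lemma diam_p_pmf_measure:
  assumes q: "finite (set_pmf q)" and p: "1 \<le> p"
  shows "diam_p p (pmf_measure q) = (if p = \<infinity> then diameter (set_pmf q)
     else measure_pmf.expectation (pair_pmf q q) (\<lambda>(x, x'). dist x x' powr enn2real p) powr (1 / enn2real p))"
proof (cases "p = \<infinity>")
  case False
  define r where "r = enn2real p"
  have r: "0 < r" using p False unfolding r_def
    by (metis enn2real_positive_iff infinity_ennreal_def less_le_trans top.not_eq_extremum zero_less_one)
  have c1: "continuous_on UNIV (\<lambda>x'. dist x x' powr r)" for x :: 'a
    using r by (intro continuous_on_powr' continuous_intros) auto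
  have c2: "continuous_on UNIV (\<lambda>x. measure_pmf.expectation q (\<lambda>x'. dist x x' powr r))"
    using r by (subst integral_measure_pmf[OF q]) (auto intro!: continuous_intros continuous_on_powr')
  show ?thesis
    using False q by (simp add: diam_p_def integral_pmf_measure c1 c2 expectation_pair flip: r_def)
qed (use q in \<open>simp add: diam_p_def measure_support_pmf_measure\<close>)

text \<open>
  Drawing \<open>x\<close> and then \<open>y\<close> from \<open>K x\<close> couples the measure with its image. For finite \<open>p\<close>, averaging over
  this coupling bounds the \<open>p\<close>-diameter of the image by the \<open>r\<close>-norm of \<open>dist + c\<close>; for \<open>p = \<infinity>\<close> the bound
  holds for each pair of support points.
\<close>

lemma diam_p_bind_le:
  assumes q: "finite (set_pmf q)" and K: "\<And>x. finite (set_pmf (K x))" and p: "1 \<le> p" and c: "0 \<le> c"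
    and le: "\<And>x x' y y'. y \<in> set_pmf (K x) \<Longrightarrow> y' \<in> set_pmf (K x') \<Longrightarrow> dist y y' \<le> dist x x' + c"
  shows "diam_p p (pmf_measure (bind_pmf q K)) \<le> diam_p p (pmf_measure q) + c"
proof (cases "p = \<infinity>")
  case True
  have "dist y y' \<le> diameter (set_pmf q) + c" if yy': "y \<in> set_pmf (bind_pmf q K)" "y' \<in> set_pmf (bind_pmf q K)" for y y'
  proof -
    obtain x x' where x: "x \<in> set_pmf q" "y \<in> set_pmf (K x)" "x' \<in> set_pmf q" "y' \<in> set_pmf (K x')"
      using yy' by auto
    then show ?thesis using le[of y x y' x'] diameter_bounded_bound[OF finite_imp_bounded[OF q], of x x'] by simp
  qed
  then have "diameter (set_pmf (bind_pmf q K)) \<le> diameter (set_pmf q) + c"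
    unfolding diameter_def[of "set_pmf (bind_pmf q K)"] using set_pmf_not_empty[of "bind_pmf q K"]
    by (auto intro!: cSUP_least)
  then show ?thesis using True p q K by (simp add: diam_p_pmf_measure)
next
  case False
  define r where "r = enn2real p"
  have r: "1 \<le> r" using p False unfolding r_def
    by (metis enn2real_1 enn2real_mono infinity_ennreal_def top.not_eq_extremum)
  let ?b = "bind_pmf q K"
  have b: "finite (set_pmf ?b)" using q K by simp
  have "?b \<bind> (\<lambda>y. ?b \<bind> (\<lambda>y'. return_pmf (y, y'))) =
      pair_pmf q q \<bind> (\<lambda>(x, x'). pair_pmf (K x) (K x'))"
    by (simp add: pair_pmf_def bind_assoc_pmf bind_return_pmf) (subst bind_commute_pmf, rule refl)
  then have pb: "pair_pmf ?b ?b = pair_pmf q q \<bind> (\<lambda>z. pair_pmf (K (fst z)) (K (snd z)))"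
    by (simp add: pair_pmf_def case_prod_unfold)
  have "measure_pmf.expectation (pair_pmf ?b ?b) (\<lambda>(y, y'). dist y y' powr r)
     = measure_pmf.expectation (pair_pmf q q) (\<lambda>z. measure_pmf.expectation (pair_pmf (K (fst z)) (K (snd z))) (\<lambda>(y, y'). dist y y' powr r))"
    unfolding pb using q K by (intro expectation_bind) auto
  also have "\<dots> \<le> measure_pmf.expectation (pair_pmf q q) (\<lambda>z. measure_pmf.expectation (pair_pmf (K (fst z)) (K (snd z))) (\<lambda>_. (dist (fst z) (snd z) + c) powr r))"
    using q K le r by (intro expectation_mono_finite) (auto intro!: powr_mono2)
  also have "\<dots> = measure_pmf.expectation (pair_pmf q q) (\<lambda>z. (dist (fst z) (snd z) + c) powr r)"
    by simp
  finally have "measure_pmf.expectation (pair_pmf ?b ?b) (\<lambda>(y, y'). dist y y' powr r) powr (1 / r)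
      \<le> measure_pmf.expectation (pair_pmf q q) (\<lambda>z. (dist (fst z) (snd z) + c) powr r) powr (1 / r)"
    using r by (intro powr_mono2) (auto intro!: integral_nonneg_AE)
  also have "\<dots> \<le> measure_pmf.expectation (pair_pmf q q) (\<lambda>z. dist (fst z) (snd z) powr r) powr (1 / r) + c"
    using q c r by (intro Minkowski_add_const) auto
  finally show ?thesis using q b p False
    by (simp add: diam_p_pmf_measure case_prod_unfold flip: r_def)
qed


section \<open>The weak topology\<close>

lemma topspace_P_fin_top [simp]: "topspace (P_fin_top :: 'x::metric_space measure topology) = P_fin"
proof -
  have "\<exists>(f::'x \<Rightarrow> real) U. P_fin = {\<mu>\<in>P_fin. (\<integral>x. f x \<partial>\<mu>) \<in> U} \<and> continuous_on UNIV f \<and> bounded (range f) \<and> open U"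
    by (intro exI[of _ "\<lambda>_. 0"] exI[of _ UNIV]) auto
  then show ?thesis
    unfolding P_fin_top_def topology_generated_by_topspace by blast
qed

lemma continuous_map_P_fin_top_iff:
  fixes F :: "'z \<Rightarrow> 'x::metric_space measure"
  shows "continuous_map Z P_fin_top F \<longleftrightarrow> F ` topspace Z \<subseteq> P_fin \<and>
     (\<forall>f. continuous_on UNIV f \<and> bounded (range f) \<longrightarrow>
        continuous_map Z euclideanreal (\<lambda>z. \<integral>x. f x \<partial>F z))" (is "?L \<longleftrightarrow> ?R")
proof
  assume L: ?L
  have "openin Z {z \<in> topspace Z. (\<integral>x. f x \<partial>F z) \<in> U}"
    if "continuous_on UNIV f" "bounded (range f)" "open U" for f :: "'x \<Rightarrow> real" and U
  proof -
    have "openin P_fin_top {\<mu>\<in>P_fin. (\<integral>x. f x \<partial>\<mu>) \<in> U}"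
      unfolding P_fin_top_def using that by (intro topology_generated_by_Basis) blast
    from openin_continuous_map_preimage[OF L this]
    have "openin Z {z \<in> topspace Z. F z \<in> {\<mu>\<in>P_fin. (\<integral>x. f x \<partial>\<mu>) \<in> U}}" .
    moreover have "F z \<in> P_fin" if "z \<in> topspace Z" for z
      using continuous_map_funspace[OF L] that by auto
    ultimately show ?thesis by (simp cong: conj_cong)
  qed
  then show ?R
    using continuous_map_funspace[OF L] by (auto simp: continuous_map_def)
next
  assume R: ?R
  show ?L
    unfolding P_fin_top_def
  proof (rule continuous_on_generated_topo)
    fix V assume "V \<in> {{\<mu>\<in>P_fin. (\<integral>x. f x \<partial>\<mu>) \<in> U} | (f :: 'x \<Rightarrow> real) U.
        continuous_on UNIV f \<and> bounded (range f) \<and> open U}"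
    then obtain f :: "'x \<Rightarrow> real" and U where V: "V = {\<mu>\<in>P_fin. (\<integral>x. f x \<partial>\<mu>) \<in> U}"
      "continuous_on UNIV f" "bounded (range f)" "open U" by blast
    then have "openin Z {z \<in> topspace Z. (\<integral>x. f x \<partial>F z) \<in> U}"
      using R openin_continuous_map_preimage by fastforce
    also have "{z \<in> topspace Z. (\<integral>x. f x \<partial>F z) \<in> U} = F -` V \<inter> topspace Z"
      using R V by auto
    finally show "openin Z (F -` V \<inter> topspace Z)" .
  next
    show "F ` topspace Z \<subseteq> \<Union> {{\<mu>\<in>P_fin. (\<integral>x. f x \<partial>\<mu>) \<in> U} | (f :: 'x \<Rightarrow> real) U.
        continuous_on UNIV f \<and> bounded (range f) \<and> open U}"
      using R topspace_P_fin_top[where 'x = 'x] unfolding P_fin_top_def topology_generated_by_topspace by simp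
  qed
qed

lemma continuous_map_integral:
  fixes f :: "'x::metric_space \<Rightarrow> real"
  assumes "continuous_on UNIV f" "bounded (range f)"
  shows "continuous_map P_fin_top euclideanreal (\<lambda>\<mu>. \<integral>x. f x \<partial>\<mu>)"
proof -
  have "continuous_map P_fin_top P_fin_top (\<lambda>\<mu> :: 'x measure. \<mu>)" by simp
  then show ?thesis
    unfolding continuous_map_P_fin_top_iff using assms by blast
qed


section \<open>Markov kernels as maps of measures\<close>

text \<open>
  The Feller property (continuous bounded functions pull back to continuous functions) is what makes
  the induced map continuous in the weak topology. Finiteness of the supports is included since all
  measures below must stay in \<^const>\<open>P_fin\<close>.
\<close>

definition feller :: "('x::metric_space \<Rightarrow> 'y::metric_space pmf) \<Rightarrow> bool" where
  "feller K \<longleftrightarrow> (\<forall>x. finite (set_pmf (K x))) \<and>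
     (\<forall>f::'y \<Rightarrow> real. continuous_on UNIV f \<longrightarrow> bounded (range f) \<longrightarrow>
        continuous_on UNIV (\<lambda>x. measure_pmf.expectation (K x) f))"

lemma bounded_expectation:
  fixes f :: "'y \<Rightarrow> real"
  assumes "\<And>x. finite (set_pmf (K x))" "bounded (range f)"
  shows "bounded (range (\<lambda>x. measure_pmf.expectation (K x) f))"
proof -
  obtain B where B: "\<And>y. \<bar>f y\<bar> \<le> B" using assms(2) by (auto simp: bounded_iff)
  have "\<bar>measure_pmf.expectation (K x) f\<bar> \<le> B" for x
  proof -
    have "\<bar>measure_pmf.expectation (K x) f\<bar> \<le> measure_pmf.expectation (K x) (\<lambda>y. \<bar>f y\<bar>)"
      by (rule integral_abs_bound)
    also have "\<dots> \<le> measure_pmf.expectation (K x) (\<lambda>_. B)"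
      using B assms by (intro expectation_mono_finite) auto
    finally show ?thesis by simp
  qed
  then show ?thesis by (auto simp: bounded_iff)
qed

lemma feller_bind:
  assumes "feller K" "feller L"
  shows "feller (\<lambda>x. bind_pmf (K x) L)"
  using assms bounded_expectation[of L]
  by (auto simp: feller_def expectation_bind)

text \<open>
  The map \<open>\<mu> \<mapsto> \<integral> K x d\<mu>(x)\<close> of measures.
\<close>

definition lift :: "('x::metric_space \<Rightarrow> 'y::metric_space pmf) \<Rightarrow> 'x measure \<Rightarrow> 'y measure" where
  "lift K \<mu> = pmf_measure (bind_pmf (measure_to_pmf \<mu>) K)"

lemma lift_pmf_measure [simp]: "lift K (pmf_measure q) = pmf_measure (bind_pmf q K)"
  by (simp add: lift_def)

lemma lift_in_P_fin: "\<mu> \<in> P_fin \<Longrightarrow> (\<And>x. finite (set_pmf (K x))) \<Longrightarrow> lift K \<mu> \<in> P_fin"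
  by (auto elim!: P_fin_cases intro!: pmf_measure_in_P_fin)

lemma lift_lift: "lift L (lift K \<mu>) = lift (\<lambda>x. bind_pmf (K x) L) \<mu>"
  by (simp add: lift_def bind_assoc_pmf)

lemma lift_return: "\<mu> \<in> P_fin \<Longrightarrow> lift return_pmf \<mu> = \<mu>"
  by (auto elim!: P_fin_cases simp: bind_return_pmf')

lemma integral_lift:
  fixes f :: "'y::metric_space \<Rightarrow> real"
  assumes K: "feller K" and f: "continuous_on UNIV f" "bounded (range f)" and \<mu>: "\<mu> \<in> P_fin"
  shows "(\<integral>y. f y \<partial>lift K \<mu>) = (\<integral>x. measure_pmf.expectation (K x) f \<partial>\<mu>)"
  using \<mu>
proof (rule P_fin_cases)
  fix q assume "\<mu> = pmf_measure q" "finite (set_pmf q)"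
  moreover have "continuous_on UNIV (\<lambda>x. measure_pmf.expectation (K x) f)" "\<And>x. finite (set_pmf (K x))"
    using K f by (auto simp: feller_def)
  ultimately show ?thesis using f by (simp add: integral_pmf_measure expectation_bind)
qed

lemma continuous_map_lift:
  assumes "feller K"
  shows "continuous_map P_fin_top P_fin_top (lift K)"
  unfolding continuous_map_P_fin_top_iff
proof (intro conjI allI impI)
  show "lift K ` topspace P_fin_top \<subseteq> P_fin"
    using assms lift_in_P_fin by (auto simp: feller_def)
  fix f :: "'b \<Rightarrow> real" assume f: "continuous_on UNIV f \<and> bounded (range f)"
  then have "continuous_map P_fin_top euclideanreal (\<lambda>\<mu>. \<integral>x. measure_pmf.expectation (K x) f \<partial>\<mu>)"
    using assms bounded_expectation[of K f] by (intro continuous_map_integral) (auto simp: feller_def)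
  then show "continuous_map P_fin_top euclideanreal (\<lambda>\<mu>. \<integral>x. f x \<partial>lift K \<mu>)"
    by (rule continuous_map_eq) (use assms f in \<open>simp add: integral_lift\<close>)
qed

lemma diam_p_lift_le:
  assumes "feller K" "1 \<le> p" "0 \<le> c" "\<mu> \<in> P_fin"
    and "\<And>x x' y y'. y \<in> set_pmf (K x) \<Longrightarrow> y' \<in> set_pmf (K x') \<Longrightarrow> dist y y' \<le> dist x x' + c"
  shows "diam_p p (lift K \<mu>) \<le> diam_p p \<mu> + c"
  using \<open>\<mu> \<in> P_fin\<close>
  by (rule P_fin_cases) (use assms in \<open>auto simp: feller_def intro!: diam_p_bind_le\<close>)

text \<open>
  The kernel \<open>x \<mapsto> t \<delta>\<^sub>x + (1 - t) K x\<close>; as \<open>t\<close> runs from 0 to 1 it gives the straight-line homotopy from the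
  map of measures induced by \<open>K\<close> to the identity.
\<close>

definition mix :: "('x \<Rightarrow> 'x pmf) \<Rightarrow> real \<Rightarrow> 'x \<Rightarrow> 'x pmf" where
  "mix K t x = bind_pmf (bernoulli_pmf t) (\<lambda>b. if b then return_pmf x else K x)"

lemma expectation_mix:
  fixes f :: "'x \<Rightarrow> real"
  assumes "t \<in> {0..1}" "\<And>x. finite (set_pmf (K x))"
  shows "measure_pmf.expectation (mix K t x) f = t * f x + (1 - t) * measure_pmf.expectation (K x) f"
  unfolding mix_def using assms by (subst expectation_bind) auto

lemma set_mix: "set_pmf (mix K t x) \<subseteq> insert x (set_pmf (K x))"
  by (auto simp: mix_def split: if_splits)

lemma mix_0: "mix K 0 = K"
  and mix_1: "mix K 1 = return_pmf"
proof -
  have b: "bernoulli_pmf 0 = return_pmf False" "bernoulli_pmf 1 = return_pmf True"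
  proof (rule_tac [!] pmf_eqI)
    show "pmf (bernoulli_pmf 0) i = pmf (return_pmf False) i"
      "pmf (bernoulli_pmf 1) i = pmf (return_pmf True) i" for i by (cases i; simp)+
  qed
  show "mix K 0 = K" "mix K 1 = return_pmf"
    by (simp_all add: mix_def b bind_return_pmf fun_eq_iff)
qed

lemma feller_mix:
  assumes K: "feller K" and t: "t \<in> {0..1}"
  shows "feller (mix K t)"
  unfolding feller_def
proof (intro conjI allI impI)
  show "finite (set_pmf (mix K t x))" for x
    using finite_subset[OF set_mix[of K t x]] K by (auto simp: feller_def)
  fix f :: "'a \<Rightarrow> real" assume "continuous_on UNIV f" "bounded (range f)"
  with K t show "continuous_on UNIV (\<lambda>x. measure_pmf.expectation (mix K t x) f)"
    by (auto simp: expectation_mix feller_def intro!: continuous_intros)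
qed

text \<open>
  Against a test function \<open>f\<close> the homotopy is \<open>t \<integral> f d\<mu> + (1 - t) \<integral> g d\<mu>\<close>, where \<open>g x\<close> is the mean of \<open>f\<close>
  under \<open>K x\<close>; this is jointly continuous in \<open>(t, \<mu>)\<close>.
\<close>

lemma continuous_map_lift_mix:
  assumes K: "feller K"
  shows "continuous_map (cylinder P_fin_top) P_fin_top (\<lambda>(t, \<mu>). lift (mix K t) \<mu>)"
  unfolding continuous_map_P_fin_top_iff
proof (intro conjI allI impI)
  show "(\<lambda>(t, \<mu>). lift (mix K t) \<mu>) ` topspace (cylinder P_fin_top) \<subseteq> P_fin"
    using feller_mix[OF K] by (auto simp: feller_def intro!: lift_in_P_fin)
  fix f :: "'a \<Rightarrow> real" assume f: "continuous_on UNIV f \<and> bounded (range f)"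
  define g where "g x = measure_pmf.expectation (K x) f" for x
  have g: "continuous_on UNIV g" "bounded (range g)"
    using K f bounded_expectation[of K f] by (auto simp: feller_def g_def)
  have int: "continuous_map (cylinder P_fin_top) euclideanreal (\<lambda>z. \<integral>x. h x \<partial>snd z)"
    if "continuous_on UNIV h" "bounded (range h)" for h :: "'a \<Rightarrow> real"
    using continuous_map_compose[OF continuous_map_snd continuous_map_integral[OF that]] by (simp add: o_def)
  have "continuous_map (cylinder P_fin_top) euclideanreal fst"
    using continuous_map_fst continuous_map_into_fulltopology by blast
  then have "continuous_map (cylinder P_fin_top) euclideanreal
      (\<lambda>z. fst z * (\<integral>x. f x \<partial>snd z) + (1 - fst z) * (\<integral>x. g x \<partial>snd z))"
    using f g by (intro continuous_intros int) auto
  then show "continuous_map (cylinder P_fin_top) euclideanreal (\<lambda>z. \<integral>x. f x \<partial>(case z of (t, \<mu>) \<Rightarrow> lift (mix K t) \<mu>))"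
  proof (rule continuous_map_eq)
    fix z :: "real \<times> 'a measure" assume "z \<in> topspace (cylinder P_fin_top)"
    then obtain t q where z: "z = (t, pmf_measure q)" "t \<in> {0..1}" "finite (set_pmf q)"
      by (auto elim!: P_fin_cases)
    have fin: "finite (set_pmf (K x))" for x using K by (simp add: feller_def)
    have "(\<integral>x. f x \<partial>lift (mix K t) (pmf_measure q)) = measure_pmf.expectation q (\<lambda>x. t * f x + (1 - t) * g x)"
      using feller_mix[OF K z(2)] z f fin
      by (simp add: integral_pmf_measure expectation_bind feller_def expectation_mix g_def)
    also have "\<dots> = t * measure_pmf.expectation q f + (1 - t) * measure_pmf.expectation q g"
      by (simp add: integrable_measure_pmf_finite[OF z(3)])
    finally show "fst z * (\<integral>x. f x \<partial>snd z) + (1 - fst z) * (\<integral>x. g x \<partial>snd z)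
        = (\<integral>x. f x \<partial>(case z of (t, \<mu>) \<Rightarrow> lift (mix K t) \<mu>))"
      using f g by (simp add: z integral_pmf_measure)
  qed
qed


section \<open>Isometric actions and equivariant kernels\<close>

lemma acts_onI:
  assumes G: "group G"
    and closed: "\<And>g x. g \<in> carrier G \<Longrightarrow> x \<in> S \<Longrightarrow> \<alpha> g x \<in> S"
    and one: "\<And>x. x \<in> S \<Longrightarrow> \<alpha> \<one>\<^bsub>G\<^esub> x = x"
    and mult: "\<And>g h x. g \<in> carrier G \<Longrightarrow> h \<in> carrier G \<Longrightarrow> x \<in> S \<Longrightarrow> \<alpha> (g \<otimes>\<^bsub>G\<^esub> h) x = \<alpha> g (\<alpha> h x)"
  shows "acts_on G S \<alpha>"
proof -
  interpret group G by fact
  have inv: "\<alpha> (inv\<^bsub>G\<^esub> g) (\<alpha> g x) = x" "\<alpha> g (\<alpha> (inv\<^bsub>G\<^esub> g) x) = x" if "g \<in> carrier G" "x \<in> S" for g x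
    using that one mult[of "inv\<^bsub>G\<^esub> g" g x] mult[of g "inv\<^bsub>G\<^esub> g" x] by simp_all
  have bij: "restrict (\<alpha> g) S \<in> Bij S" if "g \<in> carrier G" for g
  proof -
    have "bij_betw (\<alpha> g) S S"
      by (rule bij_betw_byWitness[where f' = "\<alpha> (inv\<^bsub>G\<^esub> g)"]) (use that inv closed in auto)
    then show ?thesis by (simp add: Bij_def cong: bij_betw_cong)
  qed
  have "restrict (\<alpha> (g \<otimes>\<^bsub>G\<^esub> h)) S = restrict (\<alpha> g) S \<otimes>\<^bsub>BijGroup S\<^esub> restrict (\<alpha> h) S"
    if "g \<in> carrier G" "h \<in> carrier G" for g h
    using that bij mult closed by (auto simp: BijGroup_def compose_def fun_eq_iff)
  then show ?thesis
    unfolding acts_on_def group_action_def group_hom_def group_hom_axioms_def hom_def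
    using bij G group_BijGroup by (auto simp: BijGroup_def)
qed

lemma acts_onD:
  assumes "acts_on G S \<alpha>" "x \<in> S" "g \<in> carrier G"
  shows acts_on_closed: "\<alpha> g x \<in> S"
    and acts_on_one: "\<alpha> \<one>\<^bsub>G\<^esub> x = x"
    and acts_on_mult: "h \<in> carrier G \<Longrightarrow> \<alpha> (g \<otimes>\<^bsub>G\<^esub> h) x = \<alpha> g (\<alpha> h x)"
proof -
  interpret A: group_action G S "\<lambda>g. restrict (\<alpha> g) S" using assms(1) by (simp add: acts_on_def)
  have cl: "\<alpha> h x \<in> S" if "h \<in> carrier G" for h
    using A.element_image[OF that assms(2) refl] assms(2) by simp
  show "\<alpha> g x \<in> S" by (rule cl[OF assms(3)])
  show "\<alpha> \<one>\<^bsub>G\<^esub> x = x"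
    using fun_cong[OF A.id_eq_one, of x] assms(2) by simp
  show "\<alpha> (g \<otimes>\<^bsub>G\<^esub> h) x = \<alpha> g (\<alpha> h x)" if "h \<in> carrier G"
    using A.composition_rule[OF assms(2,3) that] assms(2) cl[OF that] by simp
qed

locale metric_action = group G for G :: "('g, 'm) monoid_scheme" (structure) +
  fixes \<alpha> :: "'g \<Rightarrow> 'x::metric_space \<Rightarrow> 'x"
  assumes metric: "G_metric_space G \<alpha>"
begin

lemma act_one: "\<alpha> \<one> x = x"
  and act_mult: "g \<in> carrier G \<Longrightarrow> h \<in> carrier G \<Longrightarrow> \<alpha> (g \<otimes> h) x = \<alpha> g (\<alpha> h x)"
  and dist_act: "g \<in> carrier G \<Longrightarrow> dist (\<alpha> g x) (\<alpha> g x') = dist x x'"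
  using metric acts_on_one[of G UNIV \<alpha> x \<one>] acts_on_mult[of G UNIV \<alpha> x g h]
  by (auto simp: G_metric_space_def)

lemma act_inv: "g \<in> carrier G \<Longrightarrow> \<alpha> g (\<alpha> (inv g) x) = x"
  and inv_act: "g \<in> carrier G \<Longrightarrow> \<alpha> (inv g) (\<alpha> g x) = x"
  by (simp_all add: act_one flip: act_mult)

lemma continuous_act: "g \<in> carrier G \<Longrightarrow> continuous_on UNIV (\<alpha> g)"
  unfolding continuous_on_iff by (metis dist_act)

lemma feller_act: "g \<in> carrier G \<Longrightarrow> feller (\<lambda>x. return_pmf (\<alpha> g x))"
  unfolding feller_def by (auto intro: continuous_on_compose2[OF _ continuous_act])

text \<open>
  The action on measures is induced by the kernel of Dirac measures, so its properties are instances
  of those of kernels.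
\<close>

lemma push_eq_lift:
  assumes "g \<in> carrier G" "\<mu> \<in> P_fin"
  shows "push \<alpha> g \<mu> = lift (\<lambda>x. return_pmf (\<alpha> g x)) \<mu>"
  using assms(2)
proof (rule P_fin_cases)
  fix q assume q: "\<mu> = pmf_measure q"
  have m: "\<alpha> g \<in> borel_measurable borel"
    using continuous_act[OF assms(1)] by (rule borel_measurable_continuous_onI)
  have "push \<alpha> g \<mu> = distr (measure_pmf q) borel (\<alpha> g)"
    unfolding push_def q pmf_measure_def using m by (subst distr_distr) (auto simp: o_def)
  also have "\<dots> = pmf_measure (map_pmf (\<alpha> g) q)"
    unfolding pmf_measure_def map_pmf_rep_eq by (subst distr_distr) (auto simp: o_def)
  finally show ?thesis by (simp add: q map_pmf_def)
qed

lemma push_in_P_fin: "g \<in> carrier G \<Longrightarrow> \<mu> \<in> P_fin \<Longrightarrow> push \<alpha> g \<mu> \<in> P_fin"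
  by (simp add: push_eq_lift lift_in_P_fin)

lemma push_one: "\<mu> \<in> P_fin \<Longrightarrow> push \<alpha> \<one> \<mu> = \<mu>"
  by (simp add: push_eq_lift act_one lift_return)

lemma push_mult:
  "g \<in> carrier G \<Longrightarrow> h \<in> carrier G \<Longrightarrow> \<mu> \<in> P_fin \<Longrightarrow> push \<alpha> (g \<otimes> h) \<mu> = push \<alpha> g (push \<alpha> h \<mu>)"
  using push_in_P_fin[of h \<mu>] by (simp add: push_eq_lift lift_lift act_mult bind_return_pmf)

lemma push_inv: "g \<in> carrier G \<Longrightarrow> \<mu> \<in> P_fin \<Longrightarrow> push \<alpha> g (push \<alpha> (inv g) \<mu>) = \<mu>"
  and inv_push: "g \<in> carrier G \<Longrightarrow> \<mu> \<in> P_fin \<Longrightarrow> push \<alpha> (inv g) (push \<alpha> g \<mu>) = \<mu>"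
  by (simp_all add: push_one flip: push_mult)

lemma continuous_map_push: "g \<in> carrier G \<Longrightarrow> continuous_map P_fin_top P_fin_top (push \<alpha> g)"
  by (rule continuous_map_eq[OF continuous_map_lift[OF feller_act]]) (auto simp: push_eq_lift)

text \<open>
  Both the action of \<open>g\<close> and that of its inverse do not increase the \<open>p\<close>-diameter.
\<close>

lemma diam_p_push:
  assumes "g \<in> carrier G" "\<mu> \<in> P_fin" "1 \<le> p"
  shows "diam_p p (push \<alpha> g \<mu>) = diam_p p \<mu>"
proof -
  have le: "diam_p p (push \<alpha> h \<nu>) \<le> diam_p p \<nu>" if "h \<in> carrier G" "\<nu> \<in> P_fin" for h \<nu>
    using diam_p_lift_le[OF feller_act[OF that(1)] assms(3) order.refl that(2)] that
    by (simp add: push_eq_lift dist_act)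
  from le[of g \<mu>] le[of "inv g" "push \<alpha> g \<mu>"] show ?thesis
    using assms push_in_P_fin inv_push by simp
qed

lemma G_triple_P_fin:
  assumes "1 \<le> p"
  shows "G_triple G (P_fin_top, push \<alpha>, diam_p p)"
proof -
  have "acts_on G P_fin (push \<alpha>)"
    by (intro acts_onI push_in_P_fin push_one push_mult group_axioms)
  moreover have "homeomorphic_map P_fin_top P_fin_top (push \<alpha> g)" if "g \<in> carrier G" for g
    unfolding homeomorphic_map_maps homeomorphic_maps_def
    using that continuous_map_push inv_push push_inv by (intro exI[of _ "push \<alpha> (inv g)"]) auto
  ultimately show ?thesis
    using assms by (simp add: G_triple_def G_topological_space_def diam_p_push)
qed

end

definition equivariant_kernel ::
    "('g, 'm) monoid_scheme \<Rightarrow> ('g \<Rightarrow> 'x \<Rightarrow> 'x) \<Rightarrow> ('g \<Rightarrow> 'y \<Rightarrow> 'y) \<Rightarrow> ('x \<Rightarrow> 'y pmf) \<Rightarrow> bool" where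
  "equivariant_kernel G \<alpha>X \<alpha>Y K \<longleftrightarrow> (\<forall>g\<in>carrier G. \<forall>x. K (\<alpha>X g x) = map_pmf (\<alpha>Y g) (K x))"

lemma equivariant_bind:
  assumes "equivariant_kernel G \<alpha>X \<alpha>Y K" "equivariant_kernel G \<alpha>Y \<alpha>Z L"
  shows "equivariant_kernel G \<alpha>X \<alpha>Z (\<lambda>x. bind_pmf (K x) L)"
  using assms by (simp add: equivariant_kernel_def bind_map_pmf map_bind_pmf)

lemma equivariant_mix:
  assumes "equivariant_kernel G \<alpha> \<alpha> K"
  shows "equivariant_kernel G \<alpha> \<alpha> (mix K t)"
  using assms by (auto simp: equivariant_kernel_def mix_def map_bind_pmf intro!: bind_pmf_cong)

lemma G_delta_map_lift:
  assumes X: "metric_action G \<alpha>X" and Y: "metric_action G \<alpha>Y"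
    and K: "feller K" "equivariant_kernel G \<alpha>X \<alpha>Y K" and "1 \<le> p" "0 \<le> c"
    and le: "\<And>x x' y y'. y \<in> set_pmf (K x) \<Longrightarrow> y' \<in> set_pmf (K x') \<Longrightarrow> dist y y' \<le> dist x x' + c"
  shows "G_delta_map G c (P_fin_top, push \<alpha>X, diam_p p) (P_fin_top, push \<alpha>Y, diam_p p) (lift K)"
proof -
  have "lift K (push \<alpha>X g \<mu>) = push \<alpha>Y g (lift K \<mu>)" if "g \<in> carrier G" "\<mu> \<in> P_fin" for g \<mu>
  proof -
    have "lift K \<mu> \<in> P_fin" using that K by (intro lift_in_P_fin) (auto simp: feller_def)
    then show ?thesis
      using that K(2)
      by (simp add: metric_action.push_eq_lift[OF X] metric_action.push_eq_lift[OF Y] lift_lift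
          bind_return_pmf equivariant_kernel_def map_pmf_def)
  qed
  then show ?thesis
    using continuous_map_lift[OF K(1)] diam_p_lift_le[OF K(1) \<open>1 \<le> p\<close> \<open>0 \<le> c\<close> _ le]
    by (simp add: G_delta_map_def G_map_def)
qed

text \<open>
  A kernel that moves every point by at most \<open>c\<close> is homotopic to the identity along the straight line,
  since all mixtures along the way move every point by at most \<open>c\<close> and hence change distances by at
  most \<open>2 c\<close>.
\<close>

lemma G_delta_homotopic_lift_id:
  assumes X: "metric_action G \<alpha>" and K: "feller K" "equivariant_kernel G \<alpha> \<alpha> K"
    and "1 \<le> p" "0 \<le> c"
    and near: "\<And>x y. y \<in> set_pmf (K x) \<Longrightarrow> dist x y \<le> c"
    and F: "\<And>\<mu>. \<mu> \<in> P_fin \<Longrightarrow> F \<mu> = lift K \<mu>"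
  shows "G_delta_homotopic G (2 * c) (P_fin_top, push \<alpha>, diam_p p) (P_fin_top, push \<alpha>, diam_p p) F id"
proof -
  let ?A = "(P_fin_top, push \<alpha>, diam_p p)"
  have P: "G_delta_map G (2 * c) ?A ?A (lift (mix K t))" if "t \<in> {0..1}" for t
  proof (rule G_delta_map_lift[OF X X feller_mix[OF K(1) that] equivariant_mix[OF K(2)]])
    fix x x' y y' assume "y \<in> set_pmf (mix K t x)" "y' \<in> set_pmf (mix K t x')"
    then have "dist x y \<le> c" "dist x' y' \<le> c"
      using set_mix[of K t] near \<open>0 \<le> c\<close> by (metis dist_self insertE subsetD)+
    moreover have "dist y y' \<le> dist x y + dist x x' + dist x' y'"
      by metric
    ultimately show "dist y y' \<le> dist x x' + 2 * c" by linarith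
  qed (use assms in auto)
  have cong: "G_delta_map G (2 * c) ?A ?A h = G_delta_map G (2 * c) ?A ?A k"
    if hk: "\<And>\<mu>. \<mu> \<in> topspace P_fin_top \<Longrightarrow> h \<mu> = k \<mu>" for h k
  proof -
    have "continuous_map P_fin_top P_fin_top h \<longleftrightarrow> continuous_map P_fin_top P_fin_top k"
      using hk by (metis continuous_map_eq)
    then show ?thesis
      using hk metric_action.push_in_P_fin[OF X] by (simp add: G_delta_map_def G_map_def)
  qed
  have "homotopic_with (G_delta_map G (2 * c) ?A ?A) P_fin_top P_fin_top F id"
  proof (subst homotopic_with, rule cong)
    show "\<exists>h. continuous_map (cylinder P_fin_top) P_fin_top h \<and>
        (\<forall>\<mu>\<in>topspace P_fin_top. h (0, \<mu>) = F \<mu>) \<and> (\<forall>\<mu>\<in>topspace P_fin_top. h (1, \<mu>) = id \<mu>) \<and>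
        (\<forall>t\<in>{0..1}. G_delta_map G (2 * c) ?A ?A (\<lambda>\<mu>. h (t, \<mu>)))"
      using continuous_map_lift_mix[OF K(1)] P
      by (intro exI[of _ "\<lambda>(t, \<mu>). lift (mix K t) \<mu>"])
         (auto simp: mix_0 mix_1 F lift_return)
  qed auto
  then show ?thesis by (simp add: G_delta_homotopic_def)
qed


section \<open>From a correspondence to a homotopy equivalence\<close>

definition bump :: "real \<Rightarrow> ('x::metric_space \<times> 'y) \<Rightarrow> 'x \<Rightarrow> real" where
  "bump \<eta> t x = max 0 (\<eta> - dist x (fst t))"

text \<open>
  The partition of unity given by the normalised bumps around the first components. It is indexed by
  the pairs in \<open>T\<close>, so that several second components may share a first one; this is what makes the
  kernel below equivariant.
\<close>

definition net_weight :: "('x::metric_space \<times> 'y) set \<Rightarrow> real \<Rightarrow> 'x \<Rightarrow> 'x \<times> 'y \<Rightarrow> real" where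
  "net_weight T \<eta> x t = (if t \<in> T then bump \<eta> t x / (\<Sum>s\<in>T. bump \<eta> s x) else 0)"

definition net_kernel :: "('x::metric_space \<times> 'y) set \<Rightarrow> real \<Rightarrow> 'x \<Rightarrow> 'y pmf" where
  "net_kernel T \<eta> x = map_pmf snd (embed_pmf (net_weight T \<eta> x))"

definition is_net :: "('x::metric_space \<times> 'y) set \<Rightarrow> real \<Rightarrow> bool" where
  "is_net T \<eta> \<longleftrightarrow> finite T \<and> (\<forall>x. \<exists>t\<in>T. dist x (fst t) < \<eta>)"

lemma sum_bump_pos:
  assumes "is_net T \<eta>"
  shows "0 < (\<Sum>s\<in>T. bump \<eta> s x)"
proof -
  obtain t where "t \<in> T" "dist x (fst t) < \<eta>" using assms unfolding is_net_def by blast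
  then show ?thesis using assms by (intro sum_pos2[of T t]) (auto simp: bump_def is_net_def)
qed

lemma net_weight_nonneg: "0 \<le> net_weight T \<eta> x t"
  by (auto simp: net_weight_def bump_def intro!: divide_nonneg_nonneg sum_nonneg)

lemma nn_integral_net_weight:
  assumes "is_net T \<eta>"
  shows "(\<integral>\<^sup>+t. ennreal (net_weight T \<eta> x t) \<partial>count_space UNIV) = 1"
proof -
  have "(\<integral>\<^sup>+t. ennreal (net_weight T \<eta> x t) \<partial>count_space UNIV) = (\<Sum>t\<in>T. ennreal (net_weight T \<eta> x t))"
    using assms by (intro nn_integral_count_space'[of T]) (auto simp: is_net_def net_weight_def)
  also have "\<dots> = ennreal (\<Sum>t\<in>T. net_weight T \<eta> x t)"
    by (intro sum_ennreal net_weight_nonneg)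
  also have "(\<Sum>t\<in>T. net_weight T \<eta> x t) = 1"
    using sum_bump_pos[OF assms, of x] by (simp add: net_weight_def flip: sum_divide_distrib)
  finally show ?thesis by simp
qed

lemmas pmf_embed_net_weight = pmf_embed_pmf[OF net_weight_nonneg nn_integral_net_weight]
lemmas set_embed_net_weight = set_embed_pmf[OF net_weight_nonneg nn_integral_net_weight]

lemma set_net_kernel:
  assumes "is_net T \<eta>" "y \<in> set_pmf (net_kernel T \<eta> x)"
  shows "\<exists>s. (s, y) \<in> T \<and> dist x s < \<eta>"
  using assms(2) unfolding net_kernel_def set_map_pmf set_embed_net_weight[OF assms(1)]
  by (force simp: net_weight_def bump_def split: if_splits)

lemma feller_net_kernel:
  assumes net: "is_net T \<eta>"
  shows "feller (net_kernel T \<eta> :: 'x::metric_space \<Rightarrow> 'y::metric_space pmf)"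
  unfolding feller_def
proof (intro conjI allI impI)
  have T: "finite T" using net by (simp add: is_net_def)
  have sub: "set_pmf (embed_pmf (net_weight T \<eta> x)) \<subseteq> T" for x
    by (auto simp: set_embed_net_weight[OF net] net_weight_def split: if_splits)
  then show "finite (set_pmf (net_kernel T \<eta> x))" for x
    using finite_subset[OF sub T] by (simp add: net_kernel_def)
  fix f :: "'y \<Rightarrow> real"
  have "measure_pmf.expectation (net_kernel T \<eta> x) f
      = (\<Sum>t\<in>T. bump \<eta> t x / (\<Sum>s\<in>T. bump \<eta> s x) * f (snd t))" for x
    unfolding net_kernel_def integral_map_pmf using sub T
    by (subst integral_measure_pmf[of T])
       (auto simp: pmf_embed_net_weight[OF net] net_weight_def)
  moreover have "continuous_on UNIV (\<lambda>x. \<Sum>t\<in>T. bump \<eta> t x / (\<Sum>s\<in>T. bump \<eta> s x) * f (snd t))"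
    using sum_bump_pos[OF net] unfolding bump_def
    by (intro continuous_intros) (auto simp: less_imp_neq[THEN not_sym])
  ultimately show "continuous_on UNIV (\<lambda>x. measure_pmf.expectation (net_kernel T \<eta> x) f)" by simp
qed

definition diag_act :: "('g \<Rightarrow> 'x \<Rightarrow> 'x) \<Rightarrow> ('g \<Rightarrow> 'y \<Rightarrow> 'y) \<Rightarrow> 'g \<Rightarrow> 'x \<times> 'y \<Rightarrow> 'x \<times> 'y" where
  "diag_act \<alpha>X \<alpha>Y g = map_prod (\<alpha>X g) (\<alpha>Y g)"

text \<open>
  The group permutes the pairs in \<open>T\<close> and carries the weights at \<open>x\<close> to the weights at \<open>\<alpha>X g x\<close>.
\<close>

lemma equivariant_net_kernel:
  assumes X: "metric_action G \<alpha>X" and Y: "metric_action G \<alpha>Y" and net: "is_net T \<eta>"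
    and inv: "\<And>g t. g \<in> carrier G \<Longrightarrow> t \<in> T \<Longrightarrow> diag_act \<alpha>X \<alpha>Y g t \<in> T"
  shows "equivariant_kernel G \<alpha>X \<alpha>Y (net_kernel T \<eta>)"
  unfolding equivariant_kernel_def
proof (intro ballI allI)
  interpret X: metric_action G \<alpha>X by fact
  interpret Y: metric_action G \<alpha>Y by fact
  fix g x assume g: "g \<in> carrier G"
  define d where "d = diag_act \<alpha>X \<alpha>Y g"
  define d' where "d' = diag_act \<alpha>X \<alpha>Y (inv\<^bsub>G\<^esub> g)"
  have dd: "d (d' t) = t" "d' (d t) = t" for t
    using g by (cases t; simp add: d_def d'_def diag_act_def X.act_inv X.inv_act Y.act_inv Y.inv_act)+
  have d_mem: "d t \<in> T \<longleftrightarrow> t \<in> T" for t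
    using inv[OF g, of t] inv[of "inv\<^bsub>G\<^esub> g" "d t"] g dd(2)[of t] by (auto simp: d_def d'_def)
  have bij: "bij_betw d T T"
    by (rule bij_betw_byWitness[where f' = d']) (use dd d_mem in \<open>auto, metis\<close>)
  have bump: "bump \<eta> (d t) (\<alpha>X g x) = bump \<eta> t x" for t
    using g by (simp add: bump_def d_def diag_act_def X.dist_act)
  have "(\<Sum>s\<in>T. bump \<eta> s (\<alpha>X g x)) = (\<Sum>s\<in>T. bump \<eta> (d s) (\<alpha>X g x))"
    using sum.reindex_bij_betw[OF bij, of "\<lambda>s. bump \<eta> s (\<alpha>X g x)"] by simp
  then have w: "net_weight T \<eta> (\<alpha>X g x) (d t) = net_weight T \<eta> x t" for t
    by (simp add: net_weight_def d_mem bump)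
  have "embed_pmf (net_weight T \<eta> (\<alpha>X g x)) = map_pmf d (embed_pmf (net_weight T \<eta> x))"
  proof (rule pmf_eqI)
    fix t
    have "inj d" by (metis dd(2) injI)
    then have "pmf (map_pmf d (embed_pmf (net_weight T \<eta> x))) (d (d' t)) = net_weight T \<eta> x (d' t)"
      by (simp add: pmf_map_inj' pmf_embed_net_weight[OF net] del: dd)
    then show "pmf (embed_pmf (net_weight T \<eta> (\<alpha>X g x))) t = pmf (map_pmf d (embed_pmf (net_weight T \<eta> x))) t"
      using w[of "d' t"] by (simp add: dd pmf_embed_net_weight[OF net])
  qed
  then show "net_kernel T \<eta> (\<alpha>X g x) = map_pmf (\<alpha>Y g) (net_kernel T \<eta> x)"
    by (simp add: net_kernel_def pmf.map_comp o_def d_def diag_act_def)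
qed

text \<open>
  Finite nets of both spaces are completed to pairs in \<open>R\<close>, and the finitely many pairs are closed up
  under the finite group.
\<close>

lemma net_exists:
  assumes X: "metric_action G \<alpha>X" and Y: "metric_action G \<alpha>Y" and fin: "finite (carrier G)"
    and R: "G_correspondence G \<alpha>X \<alpha>Y R" and cX: "compact (UNIV :: 'x::metric_space set)"
    and cY: "compact (UNIV :: 'y::metric_space set)" and \<eta>: "0 < \<eta>"
  shows "\<exists>T :: ('x \<times> 'y) set. T \<subseteq> R \<and> is_net T \<eta> \<and> is_net (prod.swap ` T) \<eta> \<and>
     (\<forall>g\<in>carrier G. \<forall>t\<in>T. diag_act \<alpha>X \<alpha>Y g t \<in> T)"
proof -
  interpret X: metric_action G \<alpha>X by fact
  interpret Y: metric_action G \<alpha>Y by fact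
  obtain A :: "'x set" where A: "finite A" "UNIV \<subseteq> (\<Union>a\<in>A. ball a \<eta>)"
    using cX \<eta> unfolding compact_eq_totally_bounded by blast
  obtain B :: "'y set" where B: "finite B" "UNIV \<subseteq> (\<Union>b\<in>B. ball b \<eta>)"
    using cY \<eta> unfolding compact_eq_totally_bounded by blast
  have RX: "x \<in> fst ` R" and RY: "y \<in> snd ` R" for x y
    using R by (simp_all add: G_correspondence_def)
  have "\<exists>y. (x, y) \<in> R" for x using RX[of x] by auto
  then obtain y where y: "\<And>x. (x, y x) \<in> R" by metis
  have "\<exists>x. (x, y) \<in> R" for y using RY[of y] by auto
  then obtain x where x: "\<And>y. (x y, y) \<in> R" by metis
  define S where "S = (\<lambda>a. (a, y a)) ` A \<union> (\<lambda>b. (x b, b)) ` B"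
  define T where "T = (\<lambda>(g, t). diag_act \<alpha>X \<alpha>Y g t) ` (carrier G \<times> S)"
  have S: "finite S" "S \<subseteq> R" using A B x y by (auto simp: S_def)
  have ST: "S \<subseteq> T"
  proof
    fix t assume "t \<in> S"
    moreover have "diag_act \<alpha>X \<alpha>Y \<one>\<^bsub>G\<^esub> t = t"
      by (cases t) (simp add: diag_act_def X.act_one Y.act_one)
    ultimately show "t \<in> T" unfolding T_def by (intro image_eqI[of _ _ "(\<one>\<^bsub>G\<^esub>, t)"]) auto
  qed
  have "T \<subseteq> R"
  proof -
    have "diag_act \<alpha>X \<alpha>Y g t \<in> R" if "g \<in> carrier G" "t \<in> R" for g t
      using R that by (cases t) (auto simp: G_correspondence_def diag_act_def)
    then show ?thesis using S(2) by (auto simp: T_def)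
  qed
  moreover have "\<exists>t\<in>T. dist z (fst t) < \<eta>" for z
  proof -
    obtain a where "a \<in> A" "dist a z < \<eta>" using subsetD[OF A(2) UNIV_I, of z] by auto
    then show ?thesis using ST by (intro bexI[of _ "(a, y a)"]) (auto simp: S_def dist_commute)
  qed
  moreover have "\<exists>t\<in>T. dist z (snd t) < \<eta>" for z
  proof -
    obtain b where "b \<in> B" "dist b z < \<eta>" using subsetD[OF B(2) UNIV_I, of z] by auto
    then show ?thesis using ST by (intro bexI[of _ "(x b, b)"]) (auto simp: S_def dist_commute)
  qed
  moreover have "diag_act \<alpha>X \<alpha>Y g t \<in> T" if gt: "g \<in> carrier G" "t \<in> T" for g t
  proof -
    obtain h s where hs: "h \<in> carrier G" "s \<in> S" "t = diag_act \<alpha>X \<alpha>Y h s"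
      using gt by (auto simp: T_def)
    then have "diag_act \<alpha>X \<alpha>Y g t = diag_act \<alpha>X \<alpha>Y (g \<otimes>\<^bsub>G\<^esub> h) s"
      using that by (cases s) (simp add: diag_act_def X.act_mult Y.act_mult)
    then show ?thesis using hs that unfolding T_def
      by (intro image_eqI[of _ _ "(g \<otimes>\<^bsub>G\<^esub> h, s)"]) auto
  qed
  moreover have "finite T" using S fin by (simp add: T_def)
  ultimately show ?thesis by (auto simp: is_net_def)
qed

text \<open>
  Each kernel step replaces a point by one related to a point at distance less than \<open>\<eta>\<close>, and passing
  along \<open>R\<close> changes distances by at most \<open>D\<close>.
\<close>

lemma net_kernel_displacement:
  assumes net: "is_net T \<eta>" "is_net T' \<eta>" and T: "T \<subseteq> R" "prod.swap ` T' \<subseteq> R"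
    and R: "\<And>x y x' y'. (x, y) \<in> R \<Longrightarrow> (x', y') \<in> R \<Longrightarrow> \<bar>dist x x' - dist y y'\<bar> \<le> D"
  shows "y \<in> set_pmf (net_kernel T \<eta> x) \<Longrightarrow> y' \<in> set_pmf (net_kernel T \<eta> x') \<Longrightarrow> dist y y' \<le> dist x x' + (D + 2 * \<eta>)"
    and "z \<in> set_pmf (bind_pmf (net_kernel T \<eta> x) (net_kernel T' \<eta>)) \<Longrightarrow> dist x z \<le> D + 2 * \<eta>"
proof -
  assume "y \<in> set_pmf (net_kernel T \<eta> x)" "y' \<in> set_pmf (net_kernel T \<eta> x')"
  then obtain s s' where "(s, y) \<in> T" "(s', y') \<in> T" and s': "dist x s < \<eta>" "dist x' s' < \<eta>"
    by (metis set_net_kernel[OF net(1)])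
  then have s: "(s, y) \<in> R" "dist x s < \<eta>" "(s', y') \<in> R" "dist x' s' < \<eta>" using T by auto
  have "dist y y' \<le> dist s s' + D" using R[OF s(1,3)] by linarith
  moreover have "dist s s' \<le> dist x s + dist x x' + dist x' s'" by metric
  ultimately show "dist y y' \<le> dist x x' + (D + 2 * \<eta>)" using s by linarith
next
  assume "z \<in> set_pmf (bind_pmf (net_kernel T \<eta> x) (net_kernel T' \<eta>))"
  then obtain y where y: "y \<in> set_pmf (net_kernel T \<eta> x)" "z \<in> set_pmf (net_kernel T' \<eta> y)" by auto
  obtain s where "(s, y) \<in> T" "dist x s < \<eta>" using set_net_kernel[OF net(1) y(1)] by auto
  then have s: "(s, y) \<in> R" "dist x s < \<eta>" using T by auto
  obtain u where u: "(u, z) \<in> T'" "dist y u < \<eta>" using set_net_kernel[OF net(2) y(2)] by auto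
  then have "(z, u) \<in> prod.swap ` T'" by (intro image_eqI[of _ _ "(u, z)"]) auto
  then have "(z, u) \<in> R" using T by auto
  with R[OF s(1) this] have "dist s z \<le> dist y u + D" by linarith
  moreover have "dist x z \<le> dist x s + dist s z" by metric
  ultimately show "dist x z \<le> D + 2 * \<eta>" using s u by linarith
qed

text \<open>
  The kernels of \<open>T\<close> and of its converse induce the two maps. The slack between \<open>D\<close> and \<open>\<delta>\<close> pays for the
  net width, which is chosen so that \<open>\<delta> = D + 2 \<eta>\<close>.
\<close>

lemma correspondence_imp_homotopy_equivalent:
  assumes X: "metric_action G \<alpha>X" and Y: "metric_action G \<alpha>Y" and fin: "finite (carrier G)"
    and R: "G_correspondence G \<alpha>X \<alpha>Y R" and cX: "compact (UNIV :: 'x::metric_space set)"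
    and cY: "compact (UNIV :: 'y::metric_space set)" and p: "1 \<le> p"
    and D: "\<And>x y x' y'. (x, y) \<in> R \<Longrightarrow> (x', y') \<in> R \<Longrightarrow> \<bar>dist (x::'x) x' - dist (y::'y) y'\<bar> \<le> D"
    and \<delta>: "D < \<delta>"
  shows "G_delta_homotopy_equivalent G \<delta> (P_fin_top, push \<alpha>X, diam_p p) (P_fin_top, push \<alpha>Y, diam_p p)"
proof -
  define \<eta> where "\<eta> = (\<delta> - D) / 2"
  have \<eta>: "0 < \<eta>" and \<delta>_eq: "\<delta> = D + 2 * \<eta>" using \<delta> by (auto simp: \<eta>_def)
  obtain T where T: "T \<subseteq> R" "is_net T \<eta>" "is_net (prod.swap ` T) \<eta>"
    and inv: "\<And>g t. g \<in> carrier G \<Longrightarrow> t \<in> T \<Longrightarrow> diag_act \<alpha>X \<alpha>Y g t \<in> T"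
    using net_exists[OF X Y fin R cX cY \<eta>] by blast
  have inv': "diag_act \<alpha>Y \<alpha>X g t \<in> prod.swap ` T" if "g \<in> carrier G" "t \<in> prod.swap ` T" for g t
    using that inv[of g "prod.swap t"] by (force simp: diag_act_def)
  have "D \<ge> 0"
  proof -
    have "R \<noteq> {}" using R by (auto simp: G_correspondence_def)
    then obtain x y where "(x, y) \<in> R" by auto
    from D[OF this this] show ?thesis by simp
  qed
  then have \<delta>0: "0 \<le> \<delta>" using \<delta> by simp
  let ?K = "net_kernel T \<eta>" and ?L = "net_kernel (prod.swap ` T) \<eta>"
  have sw: "prod.swap ` prod.swap ` T = T" by (simp add: image_image)
  have K: "feller ?K" "equivariant_kernel G \<alpha>X \<alpha>Y ?K"
    using feller_net_kernel[OF T(2)] equivariant_net_kernel[OF X Y T(2) inv] by auto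
  have L: "feller ?L" "equivariant_kernel G \<alpha>Y \<alpha>X ?L"
    using feller_net_kernel[OF T(3)] equivariant_net_kernel[OF Y X T(3) inv'] by auto
  have D': "\<bar>dist y y' - dist x x'\<bar> \<le> D" if "(y, x) \<in> prod.swap ` R" "(y', x') \<in> prod.swap ` R" for x y x' y'
    using D[of x y x' y'] that by (auto simp: abs_minus_commute)
  have swT: "prod.swap ` T \<subseteq> prod.swap ` R" using T by auto
  note KL = net_kernel_displacement[OF T(2,3,1) _ D, unfolded sw, OF T(1), folded \<delta>_eq]
  note LK = net_kernel_displacement[OF T(3,2) swT _ D', OF swT, folded \<delta>_eq]
  let ?A = "(P_fin_top, push \<alpha>X, diam_p p)" and ?B = "(P_fin_top, push \<alpha>Y, diam_p p)"
  have "G_delta_map G \<delta> ?A ?B (lift ?K)"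
    using G_delta_map_lift[OF X Y K p \<delta>0] KL(1) by blast
  moreover have "G_delta_map G \<delta> ?B ?A (lift ?L)"
    using G_delta_map_lift[OF Y X L p \<delta>0] LK(1) by blast
  moreover have "G_delta_homotopic G (2 * \<delta>) ?A ?A (lift ?L \<circ> lift ?K) id"
    using feller_bind[OF K(1) L(1)] equivariant_bind[OF K(2) L(2)] p \<delta>0 KL(2)
    by (rule G_delta_homotopic_lift_id[OF X]) (auto simp: lift_lift)
  moreover have "G_delta_homotopic G (2 * \<delta>) ?B ?B (lift ?K \<circ> lift ?L) id"
    using feller_bind[OF L(1) K(1)] equivariant_bind[OF L(2) K(2)] p \<delta>0 LK(2)
    by (rule G_delta_homotopic_lift_id[OF Y]) (auto simp: lift_lift)
  ultimately show ?thesis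
    unfolding G_delta_homotopy_equivalent_def
    using metric_action.G_triple_P_fin[OF X p] metric_action.G_triple_P_fin[OF Y p] by blast
qed

lemma HT_le_GH:
  fixes \<alpha>X :: "'g \<Rightarrow> 'x::metric_space \<Rightarrow> 'x" and \<alpha>Y :: "'g \<Rightarrow> 'y::metric_space \<Rightarrow> 'y"
  assumes X: "metric_action G \<alpha>X" and Y: "metric_action G \<alpha>Y" and fin: "finite (carrier G)"
    and cX: "compact (UNIV :: 'x set)" and cY: "compact (UNIV :: 'y set)" and p: "1 \<le> p"
  shows "HT_dist G (P_fin_top, push \<alpha>X, diam_p p) (P_fin_top, push \<alpha>Y, diam_p p) \<le> 2 * GH_dist G \<alpha>X \<alpha>Y"
proof -
  let ?HT = "HT_dist G (P_fin_top, push \<alpha>X, diam_p p) (P_fin_top, push \<alpha>Y, diam_p p)"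
  have "?HT \<le> distortion R" if R: "G_correspondence G \<alpha>X \<alpha>Y R" for R
  proof (rule ereal_le_real)
    fix \<delta>' :: real assume le: "distortion R \<le> ereal \<delta>'"
    have D: "\<bar>dist x x' - dist y y'\<bar> \<le> \<delta>'" if "(x, y) \<in> R" "(x', y') \<in> R" for x y x' y'
    proof -
      have "ereal \<bar>dist x x' - dist y y'\<bar> \<le> distortion R"
        unfolding distortion_def using that by (intro SUP_upper2[of "((x, y), (x', y'))"]) auto
      with le show ?thesis using ereal_less_eq(3) order_trans by blast
    qed
    have "R \<noteq> {}" using R by (auto simp: G_correspondence_def)
    then have "0 \<le> \<delta>'" using D by fastforce
    have "?HT \<le> ereal \<delta>'  + ereal e" if "0 < e" for e
      unfolding HT_dist_def plus_ereal.simps using that \<open>0 \<le> \<delta>'\<close>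
        correspondence_imp_homotopy_equivalent[OF X Y fin R cX cY p D, of "\<delta>' + e"]
      by (intro INF_lower) auto
    then show "?HT \<le> ereal \<delta>'" by (rule ereal_le_epsilon2)
  qed
  then have "?HT \<le> (INF R\<in>{R. G_correspondence G \<alpha>X \<alpha>Y R}. distortion R)"
    by (intro INF_greatest) auto
  also have "\<dots> = 2 * GH_dist G \<alpha>X \<alpha>Y"
  proof -
    have "2 * ereal (1 / 2) = 1" by (simp add: one_ereal_def numeral_eq_ereal)
    then show ?thesis by (simp add: GH_dist_def flip: mult.assoc)
  qed
  finally show ?thesis .
qed


section \<open>From a homotopy equivalence to the lower bounds\<close>

lemma topspace_VR_top: "topspace (VR_top p r) = {\<mu>\<in>P_fin. 0 < r \<and> diam_p p \<mu> < r}"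
  by (auto simp: VR_top_def)

lemma continuous_map_VR_top:
  assumes F: "continuous_map Z P_fin_top F"
    and le: "\<And>z. z \<in> topspace Z \<Longrightarrow> 0 < r \<and> diam_p p (F z) < r"
  shows "continuous_map Z (VR_top p r) F"
  unfolding VR_top_def continuous_map_in_subtopology
  using F le continuous_map_funspace[OF F] by auto

lemma continuous_map_VR_incl: "r \<le> s \<Longrightarrow> continuous_map (VR_top p r) (VR_top p s) id"
  by (rule continuous_map_VR_top)
     (auto simp: topspace_VR_top, auto simp: VR_top_def intro: continuous_map_from_subtopology)

text \<open>
  At \<open>r \<le> 0\<close> the source is empty, so the condition \<open>0 < r\<close> in the thickening passes on to the target.
\<close>

lemma continuous_map_VR_delta:
  assumes "G_delta_map G \<delta> (P_fin_top, \<alpha>, diam_p p) (P_fin_top, \<beta>, diam_p p) \<Phi>" "0 \<le> \<delta>" "r + \<delta> \<le> s"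
  shows "continuous_map (VR_top p r) (VR_top p s) \<Phi>"
proof (rule continuous_map_VR_top)
  show "continuous_map (VR_top p r) P_fin_top \<Phi>"
    unfolding VR_top_def using assms by (simp add: G_delta_map_def G_map_def continuous_map_from_subtopology)
qed (use assms in \<open>fastforce simp: topspace_VR_top G_delta_map_def\<close>)

lemma homotopic_VR:
  fixes F :: "'x::metric_space measure \<Rightarrow> 'x measure"
  assumes hom: "G_delta_homotopic G \<delta> (P_fin_top, \<alpha>, diam_p p) (P_fin_top, \<alpha>, diam_p p) F id" and "0 \<le> \<delta>"
  shows "homotopic_with (\<lambda>h. True) (VR_top p r) (VR_top p (r + \<delta>)) F id"
proof -
  let ?A = "(P_fin_top, \<alpha>, diam_p p)"
  obtain h where h: "continuous_map (cylinder P_fin_top) P_fin_top h"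
    "\<And>x. h (0, x) = F x" "\<And>x. h (1, x) = id x"
    and P: "\<And>t. t \<in> {0..1} \<Longrightarrow> G_delta_map G \<delta> ?A ?A (\<lambda>x. h (t, x))"
    using hom by (auto simp: G_delta_homotopic_def homotopic_with_def)
  have "continuous_map (cylinder (VR_top p r)) (VR_top p (r + \<delta>)) h"
  proof (rule continuous_map_VR_top)
    have "cylinder (VR_top p r :: 'x measure topology) = subtopology (cylinder P_fin_top) ({0..1} \<times> {\<mu>\<in>P_fin. 0 < r \<and> diam_p p \<mu> < r})"
      unfolding VR_top_def by (simp add: prod_topology_subtopology subtopology_subtopology)
    then show "continuous_map (cylinder (VR_top p r)) P_fin_top h"
      using h(1) by (simp add: continuous_map_from_subtopology)
    fix z :: "real \<times> 'x measure" assume "z \<in> topspace (cylinder (VR_top p r))"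
    then obtain t \<mu> where "z = (t, \<mu>)" "t \<in> {0..1}" "\<mu> \<in> P_fin" "0 < r" "diam_p p \<mu> < r"
      by (auto simp: topspace_VR_top)
    then show "0 < r + \<delta> \<and> diam_p p (h z) < r + \<delta>"
      using P[of t] \<open>0 \<le> \<delta>\<close> by (fastforce simp: G_delta_map_def)
  qed
  then show ?thesis
    unfolding homotopic_with_def using h(2,3) by blast
qed

context metric_action
begin

lemma continuous_map_push_VR:
  assumes "g \<in> carrier G" "1 \<le> p"
  shows "continuous_map (VR_top p r) (VR_top p r) (push \<alpha> g)"
  by (rule continuous_map_VR_top)
     (use assms continuous_map_push in \<open>auto simp: topspace_VR_top diam_p_push, auto simp: VR_top_def continuous_map_from_subtopology\<close>)

lemma G_persistence_module_VR:
  assumes p: "1 \<le> p"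
  shows "G_persistence_module G (VR_homology TYPE('f::field) k p \<alpha>)"
proof -
  let ?V = "VR_homology TYPE('f) k p \<alpha>"
  let ?H = "\<lambda>r. fhomology k (VR_top p r) :: ('f, ('x measure, 'f) fchain set) module"
  note push = continuous_map_push_VR[OF _ p]
  have pf: "\<mu> \<in> P_fin" if "\<mu> \<in> topspace (VR_top p r)" for r and \<mu> :: "'x measure"
    using that by (simp add: topspace_VR_top)
  have pers: "persistence_module ?V"
    unfolding persistence_module_def VR_homology_def
    by (auto simp: vec_space_fhomology fhom_induced_linear[OF continuous_map_VR_incl] fhom_induced_id
         fhom_induced_compose[OF continuous_map_VR_incl continuous_map_VR_incl])
  have comp: "fhom_induced k (VR_top p r) (push \<alpha> g) (fhom_induced k (VR_top p r) (push \<alpha> h) A) =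
      fhom_induced k (VR_top p r) (push \<alpha> (g \<otimes> h)) A"
    if "g \<in> carrier G" "h \<in> carrier G" "A \<in> carrier (?H r)" for g h r A
  proof -
    have "fhom_induced k (VR_top p r) (push \<alpha> g \<circ> push \<alpha> h) A = fhom_induced k (VR_top p r) (push \<alpha> (g \<otimes> h)) A"
      by (rule fhom_induced_cong[OF continuous_map_compose[OF push push]])
         (use that pf in \<open>auto simp: push_mult\<close>)
    then show ?thesis using fhom_induced_compose[OF push[OF that(2)] push[OF that(1)] that(3)] by simp
  qed
  have one: "fhom_induced k (VR_top p r) (push \<alpha> \<one>) A = A" if "A \<in> carrier (?H r)" for r A
    using fhom_induced_cong[OF push[OF one_closed] that, of id] pf that by (simp add: fhom_induced_id push_one)
  have closed: "fhom_induced k (VR_top p r) (push \<alpha> g) A \<in> carrier (?H r)"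
    if "g \<in> carrier G" "A \<in> carrier (?H r)" for g r A
    by (rule fhom_induced_closed[OF push[OF that(1)] that(2)])
  have auto: "persistence_automorphism ?V (paction ?V g)" if g: "g \<in> carrier G" for g
    unfolding persistence_automorphism_def persistence_morphism_def
  proof (intro conjI allI impI ballI)
    show "paction ?V g r \<in> linear_maps (pspace ?V r) (pspace ?V r)" for r
      by (simp add: VR_homology_def fhom_induced_linear[OF push[OF g]])
    show "paction ?V g s (pmap ?V r s A) = pmap ?V r s (paction ?V g r A)"
      if rs: "r \<le> s" and A: "A \<in> carrier (pspace ?V r)" for r s A
    proof -
      have A': "A \<in> carrier (?H r)" using A by (simp add: VR_homology_def)
      show ?thesis
        using fhom_induced_compose[OF continuous_map_VR_incl[OF rs] push[OF g] A']
          fhom_induced_compose[OF push[OF g] continuous_map_VR_incl[OF rs] A']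
        by (simp add: VR_homology_def)
    qed
    show "bij_betw (paction ?V g r) (carrier (pspace ?V r)) (carrier (pspace ?V r))" for r
      by (rule bij_betw_byWitness[where f' = "paction ?V (inv g) r"])
         (use g closed in \<open>auto simp: VR_homology_def comp one\<close>)
  qed
  show ?thesis
    unfolding G_persistence_module_def
    using pers auto comp by (auto simp: VR_homology_def)
qed

end

lemma G_persistence_morphism_VR:
  assumes X: "metric_action G \<alpha>X" and Y: "metric_action G \<alpha>Y" and p: "1 \<le> p" and \<delta>: "0 \<le> \<delta>"
    and \<Phi>: "G_delta_map G \<delta> (P_fin_top, push \<alpha>X, diam_p p) (P_fin_top, push \<alpha>Y, diam_p p) \<Phi>"
  shows "G_persistence_morphism G (VR_homology TYPE('f::field) k p \<alpha>X)
     (pshift (VR_homology TYPE('f) k p \<alpha>Y) \<delta>) (\<lambda>r. fhom_induced k (VR_top p (r + \<delta>)) \<Phi>)"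
  unfolding G_persistence_morphism_def persistence_morphism_def
proof (intro conjI allI impI ballI)
  note cont = continuous_map_VR_delta[OF \<Phi> \<delta> order.refl]
  note incl = continuous_map_VR_incl
  let ?V = "VR_homology TYPE('f) k p \<alpha>X" and ?W = "pshift (VR_homology TYPE('f) k p \<alpha>Y) \<delta>"
  let ?T = "\<lambda>r. fhom_induced k (VR_top p (r + \<delta>)) \<Phi>"
  show "?T r \<in> linear_maps (pspace ?V r) (pspace ?W r)" for r
    by (simp add: VR_homology_def pshift_def fhom_induced_linear[OF cont])
  show "?T s (pmap ?V r s A) = pmap ?W r s (?T r A)"
    if rs: "r \<le> s" and A: "A \<in> carrier (pspace ?V r)" for r s A
  proof -
    have A': "A \<in> carrier (fhomology k (VR_top p r))" using A by (simp add: VR_homology_def)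
    have rs': "r + \<delta> \<le> s + \<delta>" using rs by simp
    show ?thesis
      using fhom_induced_compose[OF incl[OF rs] cont A'] fhom_induced_compose[OF cont incl[OF rs'] A']
      by (simp add: VR_homology_def pshift_def)
  qed
  show "?T r (paction ?V g r A) = paction ?W g r (?T r A)"
    if g: "g \<in> carrier G" and A: "A \<in> carrier (pspace ?V r)" for g r A
  proof -
    note pX = metric_action.continuous_map_push_VR[OF X g p]
    note pY = metric_action.continuous_map_push_VR[OF Y g p]
    have A': "A \<in> carrier (fhomology k (VR_top p r))" using A by (simp add: VR_homology_def)
    have "fhom_induced k (VR_top p (r + \<delta>)) (\<Phi> \<circ> push \<alpha>X g) A
        = fhom_induced k (VR_top p (r + \<delta>)) (push \<alpha>Y g \<circ> \<Phi>) A"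
      by (rule fhom_induced_cong[OF continuous_map_compose[OF pX cont] A'])
         (use \<Phi> g in \<open>auto simp: G_delta_map_def G_map_def topspace_VR_top\<close>)
    then show ?thesis
      using fhom_induced_compose[OF pX cont A'] fhom_induced_compose[OF cont pY A']
      by (simp add: VR_homology_def pshift_def)
  qed
qed

lemma homotopy_equivalent_imp_interleaved:
  assumes X: "metric_action G \<alpha>X" and Y: "metric_action G \<alpha>Y" and p: "1 \<le> p" and \<delta>: "0 \<le> \<delta>"
    and eq: "G_delta_homotopy_equivalent G \<delta> (P_fin_top, push \<alpha>X, diam_p p) (P_fin_top, push \<alpha>Y, diam_p p)"
  shows "G_interleaved G \<delta> (VR_homology TYPE('f::field) k p \<alpha>X) (VR_homology TYPE('f) k p \<alpha>Y)"
proof -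
  let ?A = "(P_fin_top, push \<alpha>X, diam_p p)" and ?B = "(P_fin_top, push \<alpha>Y, diam_p p)"
  obtain \<Phi> \<Psi> where \<Phi>: "G_delta_map G \<delta> ?A ?B \<Phi>" and \<Psi>: "G_delta_map G \<delta> ?B ?A \<Psi>"
    and h: "G_delta_homotopic G (2 * \<delta>) ?A ?A (\<Psi> \<circ> \<Phi>) id" "G_delta_homotopic G (2 * \<delta>) ?B ?B (\<Phi> \<circ> \<Psi>) id"
    using eq by (auto simp: G_delta_homotopy_equivalent_def)
  have comp: "fhom_induced k (VR_top p (r + \<delta> + \<delta>)) \<Psi>' (fhom_induced k (VR_top p (r + \<delta>)) \<Phi>' z)
      = fhom_induced k (VR_top p (r + 2 * \<delta>)) id z"
    if "G_delta_map G \<delta> (P_fin_top, \<alpha>, diam_p p) (P_fin_top, \<beta>, diam_p p) \<Phi>'"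
      "G_delta_map G \<delta> (P_fin_top, \<beta>, diam_p p) (P_fin_top, \<alpha>, diam_p p) \<Psi>'"
      "G_delta_homotopic G (2 * \<delta>) (P_fin_top, \<alpha>, diam_p p) (P_fin_top, \<alpha>, diam_p p) (\<Psi>' \<circ> \<Phi>') id"
      "z \<in> carrier (fhomology k (VR_top p r))"
    for \<Phi>' :: "'v::metric_space measure \<Rightarrow> 'w::metric_space measure" and \<Psi>' \<alpha> \<beta> r
      and z :: "('v measure, 'f) fchain set"
  proof -
    have "fhom_induced k (VR_top p (r + \<delta> + \<delta>)) \<Psi>' (fhom_induced k (VR_top p (r + \<delta>)) \<Phi>' z)
      = fhom_induced k (VR_top p (r + \<delta> + \<delta>)) (\<Psi>' \<circ> \<Phi>') z"
      by (rule fhom_induced_compose[OF continuous_map_VR_delta[OF that(1) \<delta> order.refl]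
            continuous_map_VR_delta[OF that(2) \<delta> order.refl] that(4)])
    also have "\<dots> = fhom_induced k (VR_top p (r + 2 * \<delta>)) (\<Psi>' \<circ> \<Phi>') z"
      by (simp add: algebra_simps)
    also have "\<dots> = fhom_induced k (VR_top p (r + 2 * \<delta>)) id z"
      using homotopic_VR[OF that(3)] that(4) \<delta> by (intro fhom_induced_homotopic[OF _ that(4)]) simp
    finally show ?thesis .
  qed
  show ?thesis
    unfolding G_interleaved_def
  proof (intro conjI exI)
    show "G_persistence_morphism G (VR_homology TYPE('f) k p \<alpha>X)
        (pshift (VR_homology TYPE('f) k p \<alpha>Y) \<delta>) (\<lambda>r. fhom_induced k (VR_top p (r + \<delta>)) \<Phi>)"
      by (rule G_persistence_morphism_VR[OF X Y p \<delta> \<Phi>])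
    show "G_persistence_morphism G (VR_homology TYPE('f) k p \<alpha>Y)
        (pshift (VR_homology TYPE('f) k p \<alpha>X) \<delta>) (\<lambda>r. fhom_induced k (VR_top p (r + \<delta>)) \<Psi>)"
      by (rule G_persistence_morphism_VR[OF Y X p \<delta> \<Psi>])
  qed (use metric_action.G_persistence_module_VR[OF X p] metric_action.G_persistence_module_VR[OF Y p]
        comp[OF \<Phi> \<Psi> h(1)] comp[OF \<Psi> \<Phi> h(2)] in \<open>auto simp: VR_homology_def\<close>)
qed

lemma continuous_map_dirac: "continuous_map euclidean P_fin_top (\<lambda>y. pmf_measure (return_pmf y))"
  unfolding continuous_map_P_fin_top_iff
  by (auto simp: integral_pmf_measure intro!: pmf_measure_in_P_fin)

lemma diam_p_dirac: "1 \<le> p \<Longrightarrow> diam_p p (pmf_measure (return_pmf y)) = 0"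
  by (auto simp: diam_p_pmf_measure)

text \<open>
  Precomposing with the embedding of points as Dirac measures, which have \<open>p\<close>-diameter 0, covers the
  case \<open>\<epsilon> = 0\<close>. The witness is \<open>\<eta> = \<delta> + e\<close> with small \<open>e > 0\<close>, because \<open>\<eta>\<close> has to be positive and
  the inequality defining the thickening is strict.
\<close>

lemma homotopy_equivalent_imp_c_obs_le:
  fixes \<alpha>X :: "'g \<Rightarrow> 'x::metric_space \<Rightarrow> 'x" and \<alpha>Y :: "'g \<Rightarrow> 'y::metric_space \<Rightarrow> 'y"
  assumes X: "metric_action G \<alpha>X" and Y: "metric_action G \<alpha>Y" and p: "1 \<le> p" and \<delta>: "0 \<le> \<delta>"
    and \<Psi>: "G_delta_map G \<delta> (P_fin_top, push \<alpha>Y, diam_p p) (P_fin_top, push \<alpha>X, diam_p p) \<Psi>"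
    and \<epsilon>: "0 \<le> \<epsilon>"
  shows "c_obs G p \<alpha>X \<alpha>Y \<epsilon> \<le> ereal \<delta>"
proof (rule ereal_le_epsilon2)
  fix e :: real assume e: "0 < e"
  have eq: "\<Psi> (push \<alpha>Y g \<mu>) = push \<alpha>X g (\<Psi> \<mu>)" if "g \<in> carrier G" "\<mu> \<in> P_fin" for g \<mu>
    using \<Psi> that by (simp add: G_delta_map_def G_map_def)
  have pos: "0 < \<delta> + e" using \<delta> e by simp
  show "c_obs G p \<alpha>X \<alpha>Y \<epsilon> \<le> ereal \<delta> + ereal e"
  proof (cases "\<epsilon> = 0")
    case True
    let ?f = "\<lambda>y. \<Psi> (pmf_measure (return_pmf y))"
    have dirac: "pmf_measure (return_pmf y) \<in> P_fin" for y :: 'y by (intro pmf_measure_in_P_fin) simp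
    have "continuous_map euclidean P_fin_top ?f"
      using continuous_map_compose[OF continuous_map_dirac, of P_fin_top \<Psi>] \<Psi>
      by (simp add: G_delta_map_def G_map_def o_def)
    moreover have "diam_p p (?f y) < \<delta> + e" for y
      using \<Psi> dirac[of y] diam_p_dirac[OF p, of y] e by (fastforce simp: G_delta_map_def)
    ultimately have "continuous_map euclidean (VR_top p (\<delta> + e)) ?f"
      using pos by (intro continuous_map_VR_top) auto
    moreover have "?f (\<alpha>Y g y) = push \<alpha>X g (?f y)" if "g \<in> carrier G" for g y
      using that dirac[of y]
      by (simp add: metric_action.push_eq_lift[OF Y] bind_return_pmf flip: eq)
    ultimately have "G_map G euclidean \<alpha>Y (VR_top p (\<delta> + e)) (push \<alpha>X) ?f"
      by (simp add: G_map_def)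
    then show ?thesis unfolding c_obs_def plus_ereal.simps using True pos by (auto intro!: INF_lower)
  next
    case False
    have "continuous_map (VR_top p \<epsilon>) (VR_top p (\<epsilon> + (\<delta> + e))) \<Psi>"
      using continuous_map_VR_delta[OF \<Psi> \<delta>] e by simp
    then have "G_map G (VR_top p \<epsilon>) (push \<alpha>Y) (VR_top p (\<epsilon> + (\<delta> + e))) (push \<alpha>X) \<Psi>"
      using eq by (auto simp: G_map_def topspace_VR_top)
    then show ?thesis unfolding c_obs_def plus_ereal.simps using False pos by (auto intro!: INF_lower)
  qed
qed

theorem mainTheorem1:
  fixes G :: "('g, 'm) monoid_scheme"
    and \<alpha>X :: "'g \<Rightarrow> 'x::metric_space \<Rightarrow> 'x"
    and \<alpha>Y :: "'g \<Rightarrow> 'y::metric_space \<Rightarrow> 'y"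
    and p :: ennreal
    and k :: nat
  assumes "group G" and "finite (carrier G)"
    and "G_metric_space G \<alpha>X" and "compact (UNIV :: 'x set)"
    and "G_metric_space G \<alpha>Y" and "compact (UNIV :: 'y set)"
    and "1 \<le> p"
  shows "2 * GH_dist G \<alpha>X \<alpha>Y \<ge>
           HT_dist G (P_fin_top, push \<alpha>X, diam_p p) (P_fin_top, push \<alpha>Y, diam_p p)
       \<and> HT_dist G (P_fin_top, push \<alpha>X, diam_p p) (P_fin_top, push \<alpha>Y, diam_p p) \<ge>
           interleaving_dist G (VR_homology TYPE('f::field) k p \<alpha>X)
             (VR_homology TYPE('f) k p \<alpha>Y)
       \<and> HT_dist G (P_fin_top, push \<alpha>X, diam_p p) (P_fin_top, push \<alpha>Y, diam_p p) \<ge>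
           (SUP \<epsilon>\<in>{0..}. c_obs G p \<alpha>X \<alpha>Y \<epsilon>)"
proof -
  have X: "metric_action G \<alpha>X" and Y: "metric_action G \<alpha>Y"
    using assms by (simp_all add: metric_action_def metric_action_axioms_def)
  let ?A = "(P_fin_top, push \<alpha>X, diam_p p)" and ?B = "(P_fin_top, push \<alpha>Y, diam_p p)"
  have "interleaving_dist G (VR_homology TYPE('f) k p \<alpha>X) (VR_homology TYPE('f) k p \<alpha>Y) \<le> HT_dist G ?A ?B"
    unfolding interleaving_dist_def HT_dist_def
    using homotopy_equivalent_imp_interleaved[OF X Y assms(7)]
    by (intro INF_superset_mono) auto
  moreover have "c_obs G p \<alpha>X \<alpha>Y \<epsilon> \<le> HT_dist G ?A ?B" if "\<epsilon> \<in> {0..}" for \<epsilon>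
    unfolding HT_dist_def
    using homotopy_equivalent_imp_c_obs_le[OF X Y assms(7)] that
    by (intro INF_greatest) (auto simp: G_delta_homotopy_equivalent_def)
  ultimately show ?thesis
    using HT_le_GH[OF X Y assms(2,4,6,7)] by (auto intro!: SUP_least)
qed

end
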